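(* (Selection adequacy) For any program $M:\sigma$, if $\mathrm{Op}_s(M)=\langle r,V\rangle$ then $\mathcal S[\![M]\!](0)=\langle r,\mathcal S_p[\![V]\!]\rangle$, where $0$ is the constantly $0$ reward function $\mathcal S[\![\sigma]\!]\to R$. (That is, $\mathcal S[\![M]\!](0)=W(\mathcal S_p)(\mathrm{Op}_s(M))$.)
   Context: **Language.** Fix base types $b$, including $\mathtt{Bool}$ and $\mathtt{Rew}$; for each $b$ a set $\mathrm{Con}_b$ of constants $c:b$ (including $\mathtt{tt},\mathtt{ff}:\mathtt{Bool}$, $0:\mathtt{Rew}$); and function symbols $f:b_1\ldots b_m\to b$, including $=_b\,:b\,b\to\mathtt{Bool}$ for each $b$, $+:\mathtt{Rew}\,\mathtt{Rew}\to\mathtt{Rew}$ and $\le\,:\mathtt{Rew}\,\mathtt{Rew}\to\mathtt{Bool}$. Types: $\sigma::=b\mid\mathtt{Unit}\mid\sigma\times\sigma\mid\sigma\to\sigma$. Terms: $M::=x\mid c\mid f(M_1,\dots,M_m)\mid\mathtt{if}\,L\,\mathtt{then}\,M\,\mathtt{else}\,N\mid M\,\mathtt{or}\,N\mid N\cdot M\mid *\mid\langle M,N\rangle\mid\mathtt{fst}(M)\mid\mathtt{snd}(M)\mid\lambda x{:}\sigma.M\mid MN$, up to $\alpha$-equivalence, with standard simple typing; $M\,\mathtt{or}\,N:\sigma$ when $M,N:\sigma$, and $N\cdot M:\sigma$ when $N:\mathtt{Rew}$, $M:\sigma$. Programs are closed well-typed terms. Values (closed): $V::=c\mid *\mid\langle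 V,W\rangle\mid\lambda x{:}\sigma.M$; $\mathrm{Val}_\sigma$ is the set of values of type $\sigma$. Effect values: $E::=V\mid E_1\,\mathtt{or}\,E_2\mid c\cdot E$ ($c:\mathtt{Rew}$). **Ordinary operational semantics.** Evaluation contexts (closed): $\mathcal E::=[\,]\mid f(c_1,\dots,c_{k-1},\mathcal E,M_{k+1},\dots,M_m)\mid\mathtt{if}\,\mathcal E\,\mathtt{then}\,M\,\mathtt{else}\,N\mid\mathcal E\cdot M\mid\langle\mathcal E,N\rangle\mid\langle V,\mathcal E\rangle\mid\mathtt{fst}(\mathcal E)\mid\mathtt{snd}(\mathcal E)\mid\mathcal EN\mid(\lambda x{:}\sigma.M)\mathcal E$. Constants $\mathrm{val}_f(c_1,\dots,c_m):b$ are given for all $f$ and $c_i:b_i$, with $\mathrm{val}_{=_b}(c,c')=\mathtt{tt}$ if $c=c'$, else $\mathtt{ff}$. Steps $\mathcal E[Q]\to\mathcal E[Q']$ arise from: $f(c_1,\dots,c_m)\to\mathrm{val}_f(c_1,\dots,c_m)$; $\mathtt{if}\,\mathtt{tt}\,\mathtt{then}\,M\,\mathtt{else}\,N\to M$; $\mathtt{if}\,\mathtt{ff}\,\mathtt{then}\,M\,\mathtt{else}\,N\to N$; $\mathtt{fst}\langle V,W\rangle\to V$; $\mathtt{snd}\langle V,W\rangle\to W$; $(\lambda x{:}\sigma.M)V\to M[V/x]$. Evaluation is deterministic and terminating, and each program $M:\sigma$ has an effect value $\mathrm{Op}(M):\sigma$ determined by $\mathrm{Op}(V)=V$; $\mathrm{Op}(M)=\mathrm{Op}(M')$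 if $M\to M'$; $\mathrm{Op}(\mathcal E[M_1\,\mathtt{or}\,M_2])=\mathrm{Op}(\mathcal E[M_1])\,\mathtt{or}\,\mathrm{Op}(\mathcal E[M_2])$; $\mathrm{Op}(\mathcal E[c\cdot M_1])=c\cdot\mathrm{Op}(\mathcal E[M_1])$. **Rewards and interpretation.** $R$ is a set with a commutative monoid structure $(+,0)$ and a total order $\le$ such that $r\le s\iff r+t\le s+t$. Given are nonempty sets $[\![b]\!]$ with $[\![\mathtt{Bool}]\!]=\{0,1\}$, $[\![\mathtt{Rew}]\!]=R$; elements $[\![c]\!]\in[\![b]\!]$ for $c:b$ with $[\![\mathtt{tt}]\!]=1$, $[\![\mathtt{ff}]\!]=0$, $[\![0]\!]=0$, distinct constants of the same type having distinct denotations, and $[\![c]\!]\ne0$ for some $c:\mathtt{Rew}$; and functions $[\![f]\!]:[\![b_1]\!]\times\cdots\times[\![b_m]\!]\to[\![b]\!]$ with $[\![+]\!]$ and $[\![\le]\!]$ the addition and (characteristic function of the) order of $R$, and $[\![f]\!]([\![c_1]\!],\dots,[\![c_m]\!])=[\![\mathrm{val}_f(c_1,\dots,c_m)]\!]$. $W(X)=R\times X$ and $W(f)\langle r,x\rangle=\langle r,f(x)\rangle$. **Selection operational semantics.** Strategies: a value has the single strategy $*$; those of $E_1\,\mathtt{or}\,E_2$ are $1s$ ($s\in\mathrm{Str}(E_1)$) and $2s$ ($s\in\mathrm{Str}(E_2)$); those of $c\cdot E$ are those of $E$. Outcomes: $\mathrm{Out}( *,V)=\langle0,V\rangle$, $\mathrm{Out}(is,E_1\,\mathtt{or}\,E_2)=\mathrm{Out}(s,E_i)$,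 and $\mathrm{Out}(s,c\cdot E)=\langle[\![c]\!]+r,V\rangle$ if $\mathrm{Out}(s,E)=\langle r,V\rangle$. $\mathrm{Rew}(s,E)=\pi_1(\mathrm{Out}(s,E))$. Strategies are totally ordered: on $E_1\,\mathtt{or}\,E_2$ all $1s$ precede all $2s'$, each group ordered as in $E_1$, resp. $E_2$; on $c\cdot E$ as in $E$. $\mathrm{argmax}$ picks the least maximizing strategy. $\mathrm{Op}_s(M)=\mathrm{Out}(\mathrm{argmax}_{s\in\mathrm{Str}(\mathrm{Op}(M))}\mathrm{Rew}(s,\mathrm{Op}(M)),\mathrm{Op}(M))\in R\times\mathrm{Val}_\sigma$. **Denotational semantics.** $S(X)=(X\to R)\to R\times X$. For $F\in S(X)$, $\gamma:X\to R$ put $\mathbf R(F|\gamma)=r+\gamma(x)$ where $\langle r,x\rangle=F(\gamma)$. $S$ is a monad with $\eta(x)(\gamma)=\langle0,x\rangle$ and, for $f:X\to S(Y)$, $f^\dagger(F)(\gamma)=\langle r+s,y\rangle$ where $\langle r,x\rangle=F(\lambda x'.\,\mathbf R(f(x')|\gamma))$ and $\langle s,y\rangle=f(x)(\gamma)$. Operations: $(G_0\,\mathtt{or}\,G_1)(\gamma)=G_0(\gamma)$ if $\mathbf R(G_0|\gamma)\ge\mathbf R(G_1|\gamma)$, else $G_1(\gamma)$; $(r\cdot G)(\gamma)=\langle r+s,x\rangle$ where $\langle s,x\rangle=G(\gamma)$. Types: $\mathcal S[\![b]\!]=[\![b]\!]$, $\mathcal S[\![\mathtt{Unit}]\!]=\{*\}$,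 $\mathcal S[\![\sigma\times\tau]\!]=\mathcal S[\![\sigma]\!]\times\mathcal S[\![\tau]\!]$, $\mathcal S[\![\sigma\to\tau]\!]=\mathcal S[\![\sigma]\!]\to S(\mathcal S[\![\tau]\!])$. A term $\Gamma\vdash M:\sigma$ denotes $\mathcal S[\![M]\!]:\mathcal S[\![\Gamma]\!]\to S(\mathcal S[\![\sigma]\!])$ by the standard left-to-right call-by-value monadic semantics: variables, constants, $*$ and abstractions via $\eta$ ($\mathcal S[\![\lambda x{:}\sigma.M]\!](\rho)=\eta(a\mapsto\mathcal S[\![M]\!](\rho,a))$); pairs, projections, applications, function symbols and conditions of conditionals by sequencing arguments left to right with Kleisli extension; $\mathcal S[\![M\,\mathtt{or}\,N]\!](\rho)=\mathcal S[\![M]\!](\rho)\,\mathtt{or}\,\mathcal S[\![N]\!](\rho)$; $\mathcal S[\![N\cdot M]\!](\rho)=(r\mapsto r\cdot\mathcal S[\![M]\!](\rho))^\dagger(\mathcal S[\![N]\!](\rho))$. For programs $\mathcal S[\![M]\!]$ is regarded as an element of $S(\mathcal S[\![\sigma]\!])$. Values $V:\sigma$ have a pure semantics $\mathcal S_p[\![V]\!]\in\mathcal S[\![\sigma]\!]$: $\mathcal S_p[\![c]\!]=[\![c]\!]$, $\mathcal S_p[\![*]\!]=*$, $\mathcal S_p[\![\langle V,V'\rangle]\!]=\langle\mathcal S_p[\![V]\!],\mathcal S_p[\![V']\!]\rangle$, $\mathcal S_p[\![\lambda x{:}\tau.N]\!]=\mathcal S[\![x{:}\tau\vdash N]\!]$.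 *)

theory Defs
  imports Main "HOL-Library.FuncSet"
begin

section \<open>Language\<close>

datatype 'b ty = Base 'b | UnitT | Prod "'b ty" "'b ty" | Arrow "'b ty" "'b ty"

text \<open>
  Base types, constants and function symbols are the elements of the types \<open>'b\<close>, \<open>'c\<close>, \<open>'f\<close>;
  the set of constants of base type \<open>b\<close> is \<open>{c. cty S c = b}\<close>.
\<close>

record ('b, 'c, 'f) signature =
  BoolB :: 'b
  RewB :: 'b
  cty :: "'c \<Rightarrow> 'b"
  ttC :: 'c
  ffC :: 'c
  zeroC :: 'c
  fargs :: "'f \<Rightarrow> 'b list"
  fres :: "'f \<Rightarrow> 'b"
  eqF :: "'b \<Rightarrow> 'f"
  plusF :: 'f
  leqF :: 'f
  valf :: "'f \<Rightarrow> 'c list \<Rightarrow> 'c"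

definition wf_signature :: "('b, 'c, 'f) signature \<Rightarrow> bool" where
  "wf_signature S \<longleftrightarrow>
     BoolB S \<noteq> RewB S \<and>
     cty S (ttC S) = BoolB S \<and> cty S (ffC S) = BoolB S \<and> cty S (zeroC S) = RewB S \<and>
     (\<forall>b. fargs S (eqF S b) = [b, b] \<and> fres S (eqF S b) = BoolB S) \<and>
     fargs S (plusF S) = [RewB S, RewB S] \<and> fres S (plusF S) = RewB S \<and>
     fargs S (leqF S) = [RewB S, RewB S] \<and> fres S (leqF S) = BoolB S \<and>
     (\<forall>f cs. map (cty S) cs = fargs S f \<longrightarrow> cty S (valf S f cs) = fres S f) \<and>
     (\<forall>b c c'. cty S c = b \<longrightarrow> cty S c' = b \<longrightarrow>
        valf S (eqF S b) [c, c'] = (if c = c' then ttC S else ffC S))"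

text \<open>
  Terms up to \<open>\<alpha>\<close>-equivalence, with de Bruijn indices. \<open>Tick N M\<close> is the term \<open>N \<cdot> M\<close>.
\<close>

datatype ('b, 'c, 'f) tm =
    Var nat
  | Con 'c
  | Fn 'f "('b, 'c, 'f) tm list"
  | Cond "('b, 'c, 'f) tm" "('b, 'c, 'f) tm" "('b, 'c, 'f) tm"
  | Or "('b, 'c, 'f) tm" "('b, 'c, 'f) tm"
  | Tick "('b, 'c, 'f) tm" "('b, 'c, 'f) tm"
  | Star
  | Pair "('b, 'c, 'f) tm" "('b, 'c, 'f) tm"
  | Fst "('b, 'c, 'f) tm"
  | Snd "('b, 'c, 'f) tm"
  | Lam "'b ty" "('b, 'c, 'f) tm"
  | App "('b, 'c, 'f) tm" "('b, 'c, 'f) tm"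

text \<open>
  Simple typing. The additional parameter \<open>T\<close> bounds the types that may be assigned in a
  derivation; ordinary typing is the case \<open>T = UNIV\<close>. The bound is needed because the sets
  \<open>\<S>\<lbrakk>\<sigma>\<rbrakk>\<close>, for all \<open>\<sigma>\<close> at once, do not fit into a single HOL type, whereas those for the
  finitely many types in a given derivation do (see \<open>typing_UNIV_imp_finite\<close> and
  \<open>wf_coding\<close> below).
\<close>

inductive typing ::
  "('b, 'c, 'f) signature \<Rightarrow> 'b ty set \<Rightarrow> 'b ty list \<Rightarrow> ('b, 'c, 'f) tm \<Rightarrow> 'b ty \<Rightarrow> bool"
  for S :: "('b, 'c, 'f) signature" and T :: "'b ty set"
  where
    typing_Var: "i < length \<Gamma> \<Longrightarrow> \<Gamma> ! i = \<sigma> \<Longrightarrow> \<sigma> \<in> T \<Longrightarrow> typing S T \<Gamma> (Var i) \<sigma>"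
  | typing_Con: "cty S c = b \<Longrightarrow> Base b \<in> T \<Longrightarrow> typing S T \<Gamma> (Con c) (Base b)"
  | typing_Fn: "list_all2 (\<lambda>M b. typing S T \<Gamma> M (Base b)) Ms (fargs S f) \<Longrightarrow>
      fres S f = b \<Longrightarrow> Base b \<in> T \<Longrightarrow> typing S T \<Gamma> (Fn f Ms) (Base b)"
  | typing_Cond: "typing S T \<Gamma> L (Base (BoolB S)) \<Longrightarrow> typing S T \<Gamma> M \<sigma> \<Longrightarrow> typing S T \<Gamma> N \<sigma> \<Longrightarrow>
      typing S T \<Gamma> (Cond L M N) \<sigma>"
  | typing_Or: "typing S T \<Gamma> M \<sigma> \<Longrightarrow> typing S T \<Gamma> N \<sigma> \<Longrightarrow> typing S T \<Gamma> (Or M N) \<sigma>"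
  | typing_Tick: "typing S T \<Gamma> N (Base (RewB S)) \<Longrightarrow> typing S T \<Gamma> M \<sigma> \<Longrightarrow>
      typing S T \<Gamma> (Tick N M) \<sigma>"
  | typing_Star: "UnitT \<in> T \<Longrightarrow> typing S T \<Gamma> Star UnitT"
  | typing_Pair: "typing S T \<Gamma> M \<sigma> \<Longrightarrow> typing S T \<Gamma> N \<tau> \<Longrightarrow> Prod \<sigma> \<tau> \<in> T \<Longrightarrow>
      typing S T \<Gamma> (Pair M N) (Prod \<sigma> \<tau>)"
  | typing_Fst: "typing S T \<Gamma> M (Prod \<sigma> \<tau>) \<Longrightarrow> \<sigma> \<in> T \<Longrightarrow> typing S T \<Gamma> (Fst M) \<sigma>"
  | typing_Snd: "typing S T \<Gamma> M (Prod \<sigma> \<tau>) \<Longrightarrow> \<tau> \<in> T \<Longrightarrow> typing S T \<Gamma> (Snd M) \<tau>"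
  | typing_Lam: "typing S T (\<sigma> # \<Gamma>) M \<tau> \<Longrightarrow> Arrow \<sigma> \<tau> \<in> T \<Longrightarrow>
      typing S T \<Gamma> (Lam \<sigma> M) (Arrow \<sigma> \<tau>)"
  | typing_App: "typing S T \<Gamma> M (Arrow \<sigma> \<tau>) \<Longrightarrow> typing S T \<Gamma> N \<sigma> \<Longrightarrow> \<tau> \<in> T \<Longrightarrow>
      typing S T \<Gamma> (App M N) \<tau>"

definition component_closed :: "'b ty set \<Rightarrow> bool" where
  "component_closed T \<longleftrightarrow>
     (\<forall>\<sigma> \<tau>. Prod \<sigma> \<tau> \<in> T \<or> Arrow \<sigma> \<tau> \<in> T \<longrightarrow> \<sigma> \<in> T \<and> \<tau> \<in> T)"

lemma typing_mono: "typing S T \<Gamma> M \<sigma> \<Longrightarrow> T \<subseteq> T' \<Longrightarrow> typing S T' \<Gamma> M \<sigma>"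
proof (induction rule: typing.induct)
  case (typing_Fn \<Gamma> Ms f b)
  then have "list_all2 (\<lambda>M b. typing S T' \<Gamma> M (Base b)) Ms (fargs S f)"
    by (auto elim: list_all2_mono)
  with typing_Fn show ?case by (auto intro: typing.typing_Fn)
qed (auto intro: typing.intros)

lemma component_closed_Un:
  assumes "component_closed A" "component_closed B"
  shows "component_closed (A \<union> B)"
  using assms unfolding component_closed_def by (metis Un_iff)

lemma component_closed_insert:
  assumes "component_closed A" "\<sigma> \<in> A" "\<tau> \<in> A"
  shows "component_closed (insert (Prod \<sigma> \<tau>) A)" "component_closed (insert (Arrow \<sigma> \<tau>) A)"
  using assms unfolding component_closed_def by (metis insert_iff ty.distinct ty.inject)+

lemma finite_component_closure:
  assumes "finite A"
  shows "\<exists>T. finite T \<and> component_closed T \<and> A \<subseteq> T"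
proof -
  have one: "\<exists>T. finite T \<and> component_closed T \<and> \<sigma> \<in> T" for \<sigma> :: "'a ty"
  proof (induction \<sigma>)
    case (Base b)
    show ?case by (rule exI[of _ "{Base b}"]) (simp add: component_closed_def)
  next
    case UnitT
    show ?case by (rule exI[of _ "{UnitT}"]) (simp add: component_closed_def)
  next
    case (Prod \<sigma> \<tau>)
    then obtain A B where "finite A" "component_closed A" "\<sigma> \<in> A"
      "finite B" "component_closed B" "\<tau> \<in> B" by auto
    then show ?case
      by (intro exI[of _ "insert (Prod \<sigma> \<tau>) (A \<union> B)"] conjI
          component_closed_insert component_closed_Un) simp_all
  next
    case (Arrow \<sigma> \<tau>)
    then obtain A B where "finite A" "component_closed A" "\<sigma> \<in> A"
      "finite B" "component_closed B" "\<tau> \<in> B" by auto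
    then show ?case
      by (intro exI[of _ "insert (Arrow \<sigma> \<tau>) (A \<union> B)"] conjI
          component_closed_insert component_closed_Un) simp_all
  qed
  from assms show ?thesis
  proof (induction A)
    case empty
    show ?case by (rule exI[of _ "{}"]) (simp add: component_closed_def)
  next
    case (insert \<sigma> A)
    then obtain T where T: "finite T" "component_closed T" "A \<subseteq> T" by blast
    obtain U where U: "finite U" "component_closed U" "\<sigma> \<in> U" using one by blast
    with T show ?case by (intro exI[of _ "T \<union> U"] conjI component_closed_Un) auto
  qed
qed

lemma typing_UNIV_imp_finite:
  assumes "typing S UNIV \<Gamma> M \<sigma>"
  shows "\<exists>T. finite T \<and> component_closed T \<and> typing S T \<Gamma> M \<sigma>"
proof -
  have merge: "\<exists>T. finite T \<and> \<rho> \<in> T \<and> typing S T \<Gamma> M \<sigma> \<and> typing S T \<Gamma>' M' \<sigma>'"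
    if "\<exists>A. finite A \<and> typing S A \<Gamma> M \<sigma>" "\<exists>B. finite B \<and> typing S B \<Gamma>' M' \<sigma>'"
    for \<rho> \<Gamma> M \<sigma> \<Gamma>' M' \<sigma>'
  proof -
    from that obtain A B where AB: "finite A" "typing S A \<Gamma> M \<sigma>" "finite B" "typing S B \<Gamma>' M' \<sigma>'"
      by blast
    have "typing S (insert \<rho> (A \<union> B)) \<Gamma> M \<sigma>" by (rule typing_mono[OF AB(2)]) blast
    moreover have "typing S (insert \<rho> (A \<union> B)) \<Gamma>' M' \<sigma>'" by (rule typing_mono[OF AB(4)]) blast
    ultimately show ?thesis using AB by (intro exI[of _ "insert \<rho> (A \<union> B)"]) simp
  qed
  from assms have "\<exists>T. finite T \<and> typing S T \<Gamma> M \<sigma>"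
  proof (induction rule: typing.induct)
    case (typing_Var i \<Gamma> \<sigma>)
    then show ?case by (intro exI[of _ "{\<sigma>}"]) (auto intro: typing.typing_Var)
  next
    case (typing_Con c b \<Gamma>)
    then show ?case by (intro exI[of _ "{Base b}"]) (auto intro: typing.typing_Con)
  next
    case (typing_Fn \<Gamma> Ms f b)
    have "list_all2 (\<lambda>M b. \<exists>T. finite T \<and> typing S T \<Gamma> M (Base b)) Ms bs \<Longrightarrow>
      \<exists>T. finite T \<and> list_all2 (\<lambda>M b. typing S T \<Gamma> M (Base b)) Ms bs" for bs
    proof (induction rule: list_all2_induct)
      case Nil
      show ?case by (rule exI[of _ "{}"]) simp
    next
      case (Cons M Ms b bs)
      then obtain A B where AB: "finite A" "typing S A \<Gamma> M (Base b)" "finite B"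
        "list_all2 (\<lambda>M b. typing S B \<Gamma> M (Base b)) Ms bs" by blast
      have "typing S (A \<union> B) \<Gamma> M (Base b)" by (rule typing_mono[OF AB(2)]) blast
      moreover have "list_all2 (\<lambda>M b. typing S (A \<union> B) \<Gamma> M (Base b)) Ms bs"
        using AB(4) by (rule list_all2_mono) (erule typing_mono, blast)
      ultimately show ?case using AB by (intro exI[of _ "A \<union> B"]) simp
    qed
    moreover have "list_all2 (\<lambda>M b. \<exists>T. finite T \<and> typing S T \<Gamma> M (Base b)) Ms (fargs S f)"
      using typing_Fn(1) by (rule list_all2_mono) blast
    ultimately obtain A where A: "finite A"
      "list_all2 (\<lambda>M b. typing S A \<Gamma> M (Base b)) Ms (fargs S f)" by blast
    have "list_all2 (\<lambda>M b'. typing S (insert (Base b) A) \<Gamma> M (Base b')) Ms (fargs S f)"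
      using A(2) by (rule list_all2_mono) (erule typing_mono, blast)
    then have "typing S (insert (Base b) A) \<Gamma> (Fn f Ms) (Base b)"
      using typing_Fn(2) by (rule typing.typing_Fn) simp
    with A(1) show ?case by (intro exI[of _ "insert (Base b) A"]) simp
  next
    case (typing_Cond \<Gamma> L M \<sigma> N)
    obtain A where A: "finite A" "typing S A \<Gamma> L (Base (BoolB S))" "typing S A \<Gamma> M \<sigma>"
      using merge[OF typing_Cond.IH(1,2)] by blast
    obtain B where B: "finite B" "typing S B \<Gamma> N \<sigma>" using typing_Cond.IH(3) by blast
    have "typing S (A \<union> B) \<Gamma> (Cond L M N) \<sigma>"
      by (intro typing.typing_Cond A(2,3)[THEN typing_mono] B(2)[THEN typing_mono]) auto
    with A(1) B(1) show ?case by (intro exI[of _ "A \<union> B"]) simp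
  next
    case (typing_Or \<Gamma> M \<sigma> N)
    from merge[OF typing_Or.IH] obtain T where "finite T" "typing S T \<Gamma> M \<sigma>" "typing S T \<Gamma> N \<sigma>"
      by blast
    then show ?case by (intro exI[of _ T] conjI typing.typing_Or)
  next
    case (typing_Tick \<Gamma> N M \<sigma>)
    from merge[OF typing_Tick.IH] obtain T where "finite T" "typing S T \<Gamma> N (Base (RewB S))" "typing S T \<Gamma> M \<sigma>"
      by blast
    then show ?case by (intro exI[of _ T] conjI typing.typing_Tick)
  next
    case (typing_Star \<Gamma>)
    show ?case by (intro exI[of _ "{UnitT}"]) (auto intro: typing.typing_Star)
  next
    case (typing_Pair \<Gamma> M \<sigma> N \<tau>)
    from merge[OF typing_Pair.IH, of "Prod \<sigma> \<tau>"] obtain T where "finite T" "typing S T \<Gamma> M \<sigma>" "typing S T \<Gamma> N \<tau>" "Prod \<sigma> \<tau> \<in> T"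
      by blast
    then show ?case by (intro exI[of _ T] conjI typing.typing_Pair)
  next
    case (typing_Fst \<Gamma> M \<sigma> \<tau>)
    from merge[OF typing_Fst.IH typing_Fst.IH, of \<sigma>] obtain T where "finite T" "typing S T \<Gamma> M (Prod \<sigma> \<tau>)" "\<sigma> \<in> T"
      by blast
    then show ?case by (intro exI[of _ T] conjI typing.typing_Fst)
  next
    case (typing_Snd \<Gamma> M \<sigma> \<tau>)
    from merge[OF typing_Snd.IH typing_Snd.IH, of \<tau>] obtain T where "finite T" "typing S T \<Gamma> M (Prod \<sigma> \<tau>)" "\<tau> \<in> T"
      by blast
    then show ?case by (intro exI[of _ T] conjI typing.typing_Snd)
  next
    case (typing_Lam \<sigma> \<Gamma> M \<tau>)
    from merge[OF typing_Lam.IH typing_Lam.IH, of "Arrow \<sigma> \<tau>"] obtain T where "finite T" "typing S T (\<sigma> # \<Gamma>) M \<tau>" "Arrow \<sigma> \<tau> \<in> T"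
      by blast
    then show ?case by (intro exI[of _ T] conjI typing.typing_Lam)
  next
    case (typing_App \<Gamma> M \<sigma> \<tau> N)
    from merge[OF typing_App.IH, of \<tau>] obtain T where "finite T" "typing S T \<Gamma> M (Arrow \<sigma> \<tau>)" "typing S T \<Gamma> N \<sigma>" "\<tau> \<in> T"
      by blast
    then show ?case by (intro exI[of _ T] conjI typing.typing_App)
  qed
  then obtain A where A: "finite A" "typing S A \<Gamma> M \<sigma>" by blast
  from finite_component_closure[OF A(1)] obtain T
    where T: "finite T" "component_closed T" "A \<subseteq> T" by blast
  from T typing_mono[OF A(2) T(3)] show ?thesis by (intro exI[of _ T] conjI)
qed

section \<open>Ordinary operational semantics\<close>

inductive is_val :: "('b, 'c, 'f) tm \<Rightarrow> bool" where
    "is_val (Con c)"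
  | "is_val Star"
  | "is_val V \<Longrightarrow> is_val W \<Longrightarrow> is_val (Pair V W)"
  | "is_val (Lam \<sigma> M)"

text \<open>
  \<open>subst k V M\<close> replaces index \<open>k\<close> in \<open>M\<close> by \<open>V\<close> and lowers the indices above \<open>k\<close>. \<open>V\<close> is
  not shifted under binders, since only closed values are ever substituted.
\<close>

fun subst :: "nat \<Rightarrow> ('b, 'c, 'f) tm \<Rightarrow> ('b, 'c, 'f) tm \<Rightarrow> ('b, 'c, 'f) tm" where
  "subst k V (Var i) = (if i < k then Var i else if i = k then V else Var (i - 1))"
| "subst k V (Con c) = Con c"
| "subst k V (Fn f Ms) = Fn f (map (subst k V) Ms)"
| "subst k V (Cond L M N) = Cond (subst k V L) (subst k V M) (subst k V N)"
| "subst k V (Or M N) = Or (subst k V M) (subst k V N)"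
| "subst k V (Tick N M) = Tick (subst k V N) (subst k V M)"
| "subst k V Star = Star"
| "subst k V (Pair M N) = Pair (subst k V M) (subst k V N)"
| "subst k V (Fst M) = Fst (subst k V M)"
| "subst k V (Snd M) = Snd (subst k V M)"
| "subst k V (Lam \<sigma> M) = Lam \<sigma> (subst (Suc k) V M)"
| "subst k V (App M N) = App (subst k V M) (subst k V N)"

datatype ('b, 'c, 'f) ectx =
    Hole
  | CFn 'f "'c list" "('b, 'c, 'f) ectx" "('b, 'c, 'f) tm list"
  | CCond "('b, 'c, 'f) ectx" "('b, 'c, 'f) tm" "('b, 'c, 'f) tm"
  | CTick "('b, 'c, 'f) ectx" "('b, 'c, 'f) tm"
  | CPairL "('b, 'c, 'f) ectx" "('b, 'c, 'f) tm"
  | CPairR "('b, 'c, 'f) tm" "('b, 'c, 'f) ectx"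
  | CFst "('b, 'c, 'f) ectx"
  | CSnd "('b, 'c, 'f) ectx"
  | CAppL "('b, 'c, 'f) ectx" "('b, 'c, 'f) tm"
  | CAppR "'b ty" "('b, 'c, 'f) tm" "('b, 'c, 'f) ectx"

primrec plug :: "('b, 'c, 'f) ectx \<Rightarrow> ('b, 'c, 'f) tm \<Rightarrow> ('b, 'c, 'f) tm" where
  "plug Hole Q = Q"
| "plug (CFn f cs E Ms) Q = Fn f (map Con cs @ plug E Q # Ms)"
| "plug (CCond E M N) Q = Cond (plug E Q) M N"
| "plug (CTick E M) Q = Tick (plug E Q) M"
| "plug (CPairL E N) Q = Pair (plug E Q) N"
| "plug (CPairR V E) Q = Pair V (plug E Q)"
| "plug (CFst E) Q = Fst (plug E Q)"
| "plug (CSnd E) Q = Snd (plug E Q)"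
| "plug (CAppL E N) Q = App (plug E Q) N"
| "plug (CAppR \<sigma> M E) Q = App (Lam \<sigma> M) (plug E Q)"

text \<open>The grammar of evaluation contexts requires the left component \<open>V\<close> in \<open>\<langle>V, E\<rangle>\<close> to be a value.\<close>

primrec is_ectx :: "('b, 'c, 'f) ectx \<Rightarrow> bool" where
  "is_ectx Hole \<longleftrightarrow> True"
| "is_ectx (CFn f cs E Ms) \<longleftrightarrow> is_ectx E"
| "is_ectx (CCond E M N) \<longleftrightarrow> is_ectx E"
| "is_ectx (CTick E M) \<longleftrightarrow> is_ectx E"
| "is_ectx (CPairL E N) \<longleftrightarrow> is_ectx E"
| "is_ectx (CPairR V E) \<longleftrightarrow> is_val V \<and> is_ectx E"
| "is_ectx (CFst E) \<longleftrightarrow> is_ectx E"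
| "is_ectx (CSnd E) \<longleftrightarrow> is_ectx E"
| "is_ectx (CAppL E N) \<longleftrightarrow> is_ectx E"
| "is_ectx (CAppR \<sigma> M E) \<longleftrightarrow> is_ectx E"

inductive redex :: "('b, 'c, 'f) signature \<Rightarrow> ('b, 'c, 'f) tm \<Rightarrow> ('b, 'c, 'f) tm \<Rightarrow> bool"
  for S :: "('b, 'c, 'f) signature"
  where
    "map (cty S) cs = fargs S f \<Longrightarrow> redex S (Fn f (map Con cs)) (Con (valf S f cs))"
  | "redex S (Cond (Con (ttC S)) M N) M"
  | "redex S (Cond (Con (ffC S)) M N) N"
  | "is_val V \<Longrightarrow> is_val W \<Longrightarrow> redex S (Fst (Pair V W)) V"
  | "is_val V \<Longrightarrow> is_val W \<Longrightarrow> redex S (Snd (Pair V W)) W"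
  | "is_val V \<Longrightarrow> redex S (App (Lam \<sigma> M) V) (subst 0 V M)"

inductive step :: "('b, 'c, 'f) signature \<Rightarrow> ('b, 'c, 'f) tm \<Rightarrow> ('b, 'c, 'f) tm \<Rightarrow> bool"
  for S :: "('b, 'c, 'f) signature"
  where
    "is_ectx E \<Longrightarrow> redex S Q Q' \<Longrightarrow> step S (plug E Q) (plug E Q')"

text \<open>
  Effect values. A leaf \<open>EVal V\<close> is meant for values \<open>V\<close> only; the rules for \<open>evaluates\<close> below
  produce no others.
\<close>

datatype ('b, 'c, 'f) effval =
    EVal "('b, 'c, 'f) tm"
  | EOr "('b, 'c, 'f) effval" "('b, 'c, 'f) effval"
  | ETick 'c "('b, 'c, 'f) effval"

text \<open>
  The graph of \<open>Op\<close>, generated by its four defining clauses.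
\<close>

inductive evaluates ::
  "('b, 'c, 'f) signature \<Rightarrow> ('b, 'c, 'f) tm \<Rightarrow> ('b, 'c, 'f) effval \<Rightarrow> bool"
  for S :: "('b, 'c, 'f) signature"
  where
    "is_val V \<Longrightarrow> evaluates S V (EVal V)"
  | "step S M M' \<Longrightarrow> evaluates S M' X \<Longrightarrow> evaluates S M X"
  | "is_ectx E \<Longrightarrow> evaluates S (plug E M1) X1 \<Longrightarrow> evaluates S (plug E M2) X2 \<Longrightarrow>
      evaluates S (plug E (Or M1 M2)) (EOr X1 X2)"
  | "is_ectx E \<Longrightarrow> evaluates S (plug E M1) X \<Longrightarrow>
      evaluates S (plug E (Tick (Con c) M1)) (ETick c X)"

definition Op :: "('b, 'c, 'f) signature \<Rightarrow> ('b, 'c, 'f) tm \<Rightarrow> ('b, 'c, 'f) effval" where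
  "Op S M = (THE X. evaluates S M X)"

section \<open>Interpretation of the base language\<close>

text \<open>
  The reward structure \<open>R\<close> is a type \<open>'r :: {comm_monoid_add, linorder}\<close> satisfying
  \<open>reward_order\<close>. (Isabelle's type classes with this cancellation law also demand a subtraction.)
\<close>

definition reward_order :: "'r :: {comm_monoid_add, linorder} itself \<Rightarrow> bool" where
  "reward_order _ \<longleftrightarrow> (\<forall>r s t :: 'r. r \<le> s \<longleftrightarrow> r + t \<le> s + t)"

datatype ('r, 'd) bval = BoolV bool | RewV 'r | DataV 'd

text \<open>The element \<open>1\<close> of \<open>\<lbrakk>Bool\<rbrakk> = {0, 1}\<close> is \<open>BoolV True\<close>, and \<open>0\<close> is \<open>BoolV False\<close>.\<close>

record ('b, 'c, 'f, 'r, 'd) interp =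
  bden :: "'b \<Rightarrow> ('r, 'd) bval set"
  cden :: "'c \<Rightarrow> ('r, 'd) bval"
  fden :: "'f \<Rightarrow> ('r, 'd) bval list \<Rightarrow> ('r, 'd) bval"

definition wf_interp ::
  "('b, 'c, 'f) signature \<Rightarrow> ('b, 'c, 'f, 'r :: {comm_monoid_add, linorder}, 'd) interp \<Rightarrow> bool"
where
  "wf_interp S I \<longleftrightarrow>
     (\<forall>b. bden I b \<noteq> {}) \<and>
     bden I (BoolB S) = range BoolV \<and> bden I (RewB S) = range RewV \<and>
     (\<forall>c. cden I c \<in> bden I (cty S c)) \<and>
     cden I (ttC S) = BoolV True \<and> cden I (ffC S) = BoolV False \<and> cden I (zeroC S) = RewV 0 \<and>
     (\<forall>c c'. cty S c = cty S c' \<longrightarrow> cden I c = cden I c' \<longrightarrow> c = c') \<and>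
     (\<exists>c. cty S c = RewB S \<and> cden I c \<noteq> RewV 0) \<and>
     (\<forall>f xs. list_all2 (\<lambda>x b. x \<in> bden I b) xs (fargs S f) \<longrightarrow> fden I f xs \<in> bden I (fres S f)) \<and>
     (\<forall>r s. fden I (plusF S) [RewV r, RewV s] = RewV (r + s)) \<and>
     (\<forall>r s. fden I (leqF S) [RewV r, RewV s] = BoolV (r \<le> s)) \<and>
     (\<forall>f cs. map (cty S) cs = fargs S f \<longrightarrow> fden I f (map (cden I) cs) = cden I (valf S f cs))"

fun the_rew :: "('r, 'd) bval \<Rightarrow> 'r" where
  "the_rew (RewV r) = r"

section \<open>Selection operational semantics\<close>

datatype strat = Done | One strat | Two strat

primrec Str :: "('b, 'c, 'f) effval \<Rightarrow> strat set" where
  "Str (EVal V) = {Done}"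
| "Str (EOr X1 X2) = One ` Str X1 \<union> Two ` Str X2"
| "Str (ETick c X) = Str X"

fun Out :: "('b, 'c, 'f, 'r :: {comm_monoid_add, linorder}, 'd) interp \<Rightarrow>
    strat \<Rightarrow> ('b, 'c, 'f) effval \<Rightarrow> 'r \<times> ('b, 'c, 'f) tm" where
  "Out I Done (EVal V) = (0, V)"
| "Out I (One s) (EOr X1 X2) = Out I s X1"
| "Out I (Two s) (EOr X1 X2) = Out I s X2"
| "Out I s (ETick c X) = (case Out I s X of (r, V) \<Rightarrow> (the_rew (cden I c) + r, V))"

definition Rew :: "('b, 'c, 'f, 'r :: {comm_monoid_add, linorder}, 'd) interp \<Rightarrow>
    strat \<Rightarrow> ('b, 'c, 'f) effval \<Rightarrow> 'r" where
  "Rew I s X = fst (Out I s X)"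

fun strat_le :: "('b, 'c, 'f) effval \<Rightarrow> strat \<Rightarrow> strat \<Rightarrow> bool" where
  "strat_le (EVal V) Done Done \<longleftrightarrow> True"
| "strat_le (EOr X1 X2) (One s) (One s') \<longleftrightarrow> strat_le X1 s s'"
| "strat_le (EOr X1 X2) (One s) (Two s') \<longleftrightarrow> True"
| "strat_le (EOr X1 X2) (Two s) (Two s') \<longleftrightarrow> strat_le X2 s s'"
| "strat_le (ETick c X) s s' \<longleftrightarrow> strat_le X s s'"
| "strat_le _ _ _ \<longleftrightarrow> False"

definition argmax :: "('s \<Rightarrow> 's \<Rightarrow> bool) \<Rightarrow> 's set \<Rightarrow> ('s \<Rightarrow> 'r :: linorder) \<Rightarrow> 's" where
  "argmax le A f =
     (THE s. s \<in> A \<and> (\<forall>s'\<in>A. f s' \<le> f s) \<and> (\<forall>s'\<in>A. (\<forall>s''\<in>A. f s'' \<le> f s') \<longrightarrow> le s s'))"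

definition Op_s :: "('b, 'c, 'f) signature \<Rightarrow>
    ('b, 'c, 'f, 'r :: {comm_monoid_add, linorder}, 'd) interp \<Rightarrow>
    ('b, 'c, 'f) tm \<Rightarrow> 'r \<times> ('b, 'c, 'f) tm" where
  "Op_s S I M =
     (let X = Op S M in Out I (argmax (strat_le X) (Str X) (\<lambda>s. Rew I s X)) X)"

section \<open>The selection monad\<close>

type_synonym ('r, 'x) sel = "('x \<Rightarrow> 'r) \<Rightarrow> 'r \<times> 'x"

definition rew :: "('r :: comm_monoid_add, 'x) sel \<Rightarrow> ('x \<Rightarrow> 'r) \<Rightarrow> 'r" where
  "rew F \<gamma> = (case F \<gamma> of (r, x) \<Rightarrow> r + \<gamma> x)"

definition eta :: "'x \<Rightarrow> ('r :: comm_monoid_add, 'x) sel" where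
  "eta x = (\<lambda>\<gamma>. (0, x))"

definition kleisli :: "('x \<Rightarrow> ('r :: comm_monoid_add, 'y) sel) \<Rightarrow> ('r, 'x) sel \<Rightarrow> ('r, 'y) sel" where
  "kleisli f F = (\<lambda>\<gamma>.
     case F (\<lambda>x'. rew (f x') \<gamma>) of (r, x) \<Rightarrow> case f x \<gamma> of (s, y) \<Rightarrow> (r + s, y))"

definition or_sel ::
  "('r :: {comm_monoid_add, linorder}, 'x) sel \<Rightarrow> ('r, 'x) sel \<Rightarrow> ('r, 'x) sel" where
  "or_sel G0 G1 = (\<lambda>\<gamma>. if rew G0 \<gamma> \<ge> rew G1 \<gamma> then G0 \<gamma> else G1 \<gamma>)"

definition tick_sel :: "'r :: comm_monoid_add \<Rightarrow> ('r, 'x) sel \<Rightarrow> ('r, 'x) sel" where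
  "tick_sel r G = (\<lambda>\<gamma>. case G \<gamma> of (s, x) \<Rightarrow> (r + s, x))"

text \<open>
  The set \<open>S(X) = (X \<rightarrow> R) \<rightarrow> R \<times> X\<close> for a set \<open>X\<close> within a type. A reward function
  \<open>X \<rightarrow> R\<close> is represented by any total function extending it, so elements of \<open>S(X)\<close> are the
  functions with second component in \<open>X\<close> whose value depends only on the restriction of the
  reward function to \<open>X\<close>.
\<close>

definition Sel :: "'x set \<Rightarrow> ('r, 'x) sel set" where
  "Sel X = {F. \<forall>\<gamma>. snd (F \<gamma>) \<in> X \<and> (\<forall>\<gamma>'. (\<forall>x\<in>X. \<gamma>' x = \<gamma> x) \<longrightarrow> F \<gamma>' = F \<gamma>)}"

primrec bind_list :: "('r :: comm_monoid_add, 'x) sel list \<Rightarrow>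
    ('x list \<Rightarrow> ('r, 'y) sel) \<Rightarrow> ('r, 'y) sel" where
  "bind_list [] k = k []"
| "bind_list (F # Fs) k = kleisli (\<lambda>x. bind_list Fs (\<lambda>xs. k (x # xs))) F"

section \<open>Denotational semantics\<close>

text \<open>
  Semantic values. The elements of \<open>\<S>\<lbrakk>\<sigma> \<rightarrow> \<tau>\<rbrakk>\<close> are actual functions
  \<open>\<S>\<lbrakk>\<sigma>\<rbrakk> \<rightarrow> S(\<S>\<lbrakk>\<tau>\<rbrakk>)\<close>, which cannot be stored directly in a datatype; they enter it
  through codes in a type \<open>'u\<close>, with \<open>enc\<close> coding a function and \<open>dec\<close> recovering it.
\<close>

datatype ('r, 'd, 'u) sval =
    BaseV "('r, 'd) bval"
  | UnitV
  | PairV "('r, 'd, 'u) sval" "('r, 'd, 'u) sval"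
  | FunV 'u

type_synonym ('r, 'd, 'u) sfun =
  "('r, 'd, 'u) sval \<Rightarrow> ('r, ('r, 'd, 'u) sval) sel"

record ('r, 'd, 'u) coding =
  enc :: "('r, 'd, 'u) sfun \<Rightarrow> 'u"
  dec :: "'u \<Rightarrow> ('r, 'd, 'u) sfun"

primrec Sty :: "('b, 'c, 'f, 'r, 'd) interp \<Rightarrow> ('r, 'd, 'u) coding \<Rightarrow>
    'b ty \<Rightarrow> ('r, 'd, 'u) sval set" where
  "Sty I K (Base b) = BaseV ` bden I b"
| "Sty I K UnitT = {UnitV}"
| "Sty I K (Prod \<sigma> \<tau>) = {PairV a b | a b. a \<in> Sty I K \<sigma> \<and> b \<in> Sty I K \<tau>}"
| "Sty I K (Arrow \<sigma> \<tau>) = (\<lambda>F. FunV (enc K F)) ` (Sty I K \<sigma> \<rightarrow>\<^sub>E Sel (Sty I K \<tau>))"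

text \<open>
  Coding is faithful on the full function space at every function type in \<open>T\<close>, so that
  \<open>Sty I K (Arrow \<sigma> \<tau>)\<close> is a bijective copy of it. For finite \<open>T\<close> this only asks
  that \<open>'u\<close> be large enough: the function spaces at the types in \<open>T\<close> are bounded by a finite
  iteration of powers of the base sets, and \<open>enc\<close> can be chosen on them successively, by
  recursion on the types. If \<open>T\<close> contains no function type, any \<open>'u\<close> will do.
\<close>

definition wf_coding :: "('b, 'c, 'f, 'r, 'd) interp \<Rightarrow> ('r, 'd, 'u) coding \<Rightarrow>
    'b ty set \<Rightarrow> bool" where
  "wf_coding I K T \<longleftrightarrow>
     (\<forall>\<sigma> \<tau>. Arrow \<sigma> \<tau> \<in> T \<longrightarrow>
        (\<forall>F \<in> Sty I K \<sigma> \<rightarrow>\<^sub>E Sel (Sty I K \<tau>). dec K (enc K F) = F))"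

fun the_base :: "('r, 'd, 'u) sval \<Rightarrow> ('r, 'd) bval" where
  "the_base (BaseV x) = x"

fun fst_sval :: "('r, 'd, 'u) sval \<Rightarrow> ('r, 'd, 'u) sval" where
  "fst_sval (PairV a b) = a"

fun snd_sval :: "('r, 'd, 'u) sval \<Rightarrow> ('r, 'd, 'u) sval" where
  "snd_sval (PairV a b) = b"

fun app_sval :: "('r, 'd, 'u) coding \<Rightarrow> ('r, 'd, 'u) sval \<Rightarrow> ('r, 'd, 'u) sfun" where
  "app_sval K (FunV u) a = dec K u a"

text \<open>
  An environment lists the values of the free variables by index. The denotation does not
  depend on the typing derivation, as types are only needed for the domain of an abstraction.
\<close>

fun sem :: "('b, 'c, 'f, 'r :: {comm_monoid_add, linorder}, 'd) interp \<Rightarrow>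
    ('r, 'd, 'u) coding \<Rightarrow> ('b, 'c, 'f) tm \<Rightarrow> ('r, 'd, 'u) sval list \<Rightarrow>
    ('r, ('r, 'd, 'u) sval) sel" where
  "sem I K (Var i) \<rho> = eta (\<rho> ! i)"
| "sem I K (Con c) \<rho> = eta (BaseV (cden I c))"
| "sem I K (Fn f Ms) \<rho> =
     bind_list (map (\<lambda>M. sem I K M \<rho>) Ms) (\<lambda>xs. eta (BaseV (fden I f (map the_base xs))))"
| "sem I K (Cond L M N) \<rho> =
     kleisli (\<lambda>x. if x = BaseV (BoolV True) then sem I K M \<rho> else sem I K N \<rho>) (sem I K L \<rho>)"
| "sem I K (Or M N) \<rho> = or_sel (sem I K M \<rho>) (sem I K N \<rho>)"
| "sem I K (Tick N M) \<rho> =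
     kleisli (\<lambda>x. tick_sel (the_rew (the_base x)) (sem I K M \<rho>)) (sem I K N \<rho>)"
| "sem I K Star \<rho> = eta UnitV"
| "sem I K (Pair M N) \<rho> =
     kleisli (\<lambda>a. kleisli (\<lambda>b. eta (PairV a b)) (sem I K N \<rho>)) (sem I K M \<rho>)"
| "sem I K (Fst M) \<rho> = kleisli (\<lambda>p. eta (fst_sval p)) (sem I K M \<rho>)"
| "sem I K (Snd M) \<rho> = kleisli (\<lambda>p. eta (snd_sval p)) (sem I K M \<rho>)"
| "sem I K (Lam \<sigma> M) \<rho> = eta (FunV (enc K (\<lambda>a\<in>Sty I K \<sigma>. sem I K M (a # \<rho>))))"
| "sem I K (App M N) \<rho> =
     kleisli (\<lambda>g. kleisli (\<lambda>a. app_sval K g a) (sem I K N \<rho>)) (sem I K M \<rho>)"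

fun pure_sem :: "('b, 'c, 'f, 'r :: {comm_monoid_add, linorder}, 'd) interp \<Rightarrow>
    ('r, 'd, 'u) coding \<Rightarrow> ('b, 'c, 'f) tm \<Rightarrow> ('r, 'd, 'u) sval" where
  "pure_sem I K (Con c) = BaseV (cden I c)"
| "pure_sem I K Star = UnitV"
| "pure_sem I K (Pair V W) = PairV (pure_sem I K V) (pure_sem I K W)"
| "pure_sem I K (Lam \<tau> N) = FunV (enc K (\<lambda>a\<in>Sty I K \<tau>. sem I K N [a]))"

end

theory Submission
  imports Defs
begin

text \<open>
  A logical relation on closed values, indexed by types, gives termination and soundness together:
  a term is adequate for a set of values when it evaluates to an effect value with leaves in that
  set and with the same denotation. Adequacy is closed under evaluation contexts because Kleisli
  extension commutes with the two effect operations. It remains to compare the denotation of an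
  effect value at the zero reward function with the outcome of its least optimal strategy, by
  induction; cancellation in \<open>R\<close> is what makes a strategy optimal for \<open>c \<cdot> E\<close> iff it is
  optimal for \<open>E\<close>.
\<close>

section \<open>The selection monad\<close>

lemma kleisli_eta [simp]: "kleisli f (eta x) = f x"
  by (rule ext) (simp add: kleisli_def eta_def split: prod.split)

lemma rew_kleisli: "rew (kleisli f F) \<gamma> = rew F (\<lambda>x. rew (f x) \<gamma>)"
  by (simp add: rew_def kleisli_def add.assoc split: prod.split)

text \<open>By \<open>rew_kleisli\<close> both sides compare the same two rewards at every reward
  function, hence take the same branch. Semantically, a choice can be pulled out of an evaluation
  context.\<close>

lemma kleisli_or: "kleisli f (or_sel F G) = or_sel (kleisli f F) (kleisli f G)"
  by (rule ext) (simp add: or_sel_def rew_kleisli, simp add: kleisli_def or_sel_def)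

lemma kleisli_tick: "kleisli f (tick_sel r F) = tick_sel r (kleisli f F)"
  by (rule ext) (simp add: kleisli_def tick_sel_def add.assoc split: prod.split)

text \<open>Arguments that are already values contribute no effect. This handles the context of a
  function symbol, where a prefix of the arguments consists of constants.\<close>

lemma bind_list_eta_append:
  "bind_list (map eta xs @ Fs) k = bind_list Fs (\<lambda>ys. k (xs @ ys))"
  by (induction xs arbitrary: k) simp_all

section \<open>Membership in the sets \<open>Sel X\<close>\<close>

lemma snd_Sel: "F \<in> Sel X \<Longrightarrow> snd (F \<gamma>) \<in> X"
  by (simp add: Sel_def)

lemma Sel_cong: "F \<in> Sel X \<Longrightarrow> (\<And>x. x \<in> X \<Longrightarrow> \<gamma>' x = \<gamma> x) \<Longrightarrow> F \<gamma>' = F \<gamma>"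
  by (simp add: Sel_def)

lemma SelI:
  assumes "\<And>\<gamma>. snd (F \<gamma>) \<in> X" "\<And>\<gamma> \<gamma>'. (\<And>x. x \<in> X \<Longrightarrow> \<gamma>' x = \<gamma> x) \<Longrightarrow> F \<gamma>' = F \<gamma>"
  shows "F \<in> Sel X"
  using assms unfolding Sel_def by blast

text \<open>The reward function is finally applied to the selected element, and that element lies in
  \<open>X\<close>.\<close>

lemma rew_Sel_cong:
  assumes "F \<in> Sel X" "\<And>x. x \<in> X \<Longrightarrow> \<gamma>' x = \<gamma> x"
  shows "rew F \<gamma>' = rew F \<gamma>"
  using Sel_cong[OF assms] assms(2)[OF snd_Sel[OF assms(1), of \<gamma>]]
  by (simp add: rew_def case_prod_unfold)

lemma eta_Sel: "x \<in> X \<Longrightarrow> eta x \<in> Sel X"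
  by (auto intro: SelI simp: eta_def)

lemma kleisli_Sel:
  fixes F :: "('r :: comm_monoid_add, 'x) sel" and f :: "'x \<Rightarrow> ('r, 'y) sel"
  assumes F: "F \<in> Sel X" and f: "\<And>x. x \<in> X \<Longrightarrow> f x \<in> Sel Y"
  shows "kleisli f F \<in> Sel Y"
proof (rule SelI)
  fix \<gamma>
  show "snd (kleisli f F \<gamma>) \<in> Y"
    using snd_Sel[OF f[OF snd_Sel[OF F]]] by (simp add: kleisli_def case_prod_unfold)
next
  fix \<gamma> \<gamma>' :: "'y \<Rightarrow> 'r" assume eq: "\<And>y. y \<in> Y \<Longrightarrow> \<gamma>' y = \<gamma> y"
  \<comment> \<open>The induced reward functions are known to agree only on \<open>X\<close>, where
    \<open>f\<close> lands in \<open>Sel Y\<close>; \<open>F\<close> cannot see beyond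
    \<open>X\<close>.\<close>
  have 1: "F (\<lambda>x'. rew (f x') \<gamma>') = F (\<lambda>x'. rew (f x') \<gamma>)"
    by (rule Sel_cong[OF F], rule rew_Sel_cong[OF f eq])
  show "kleisli f F \<gamma>' = kleisli f F \<gamma>"
    using Sel_cong[OF f[OF snd_Sel[OF F]] eq] by (simp add: kleisli_def 1 case_prod_unfold)
qed

lemma or_Sel:
  fixes F G :: "('r :: {comm_monoid_add, linorder}, 'x) sel"
  assumes "F \<in> Sel X" "G \<in> Sel X"
  shows "or_sel F G \<in> Sel X"
proof (rule SelI)
  fix \<gamma> \<gamma>' :: "'x \<Rightarrow> 'r" assume eq: "\<And>x. x \<in> X \<Longrightarrow> \<gamma>' x = \<gamma> x"
  have "rew F \<gamma>' = rew F \<gamma>" "rew G \<gamma>' = rew G \<gamma>" "F \<gamma>' = F \<gamma>" "G \<gamma>' = G \<gamma>"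
    using rew_Sel_cong Sel_cong assms eq by blast+
  then show "or_sel F G \<gamma>' = or_sel F G \<gamma>" by (simp add: or_sel_def)
qed (simp add: or_sel_def assms[THEN snd_Sel])

lemma tick_Sel:
  fixes F :: "('r :: comm_monoid_add, 'x) sel"
  assumes "F \<in> Sel X"
  shows "tick_sel r F \<in> Sel X"
proof (rule SelI)
  fix \<gamma> \<gamma>' :: "'x \<Rightarrow> 'r" assume eq: "\<And>x. x \<in> X \<Longrightarrow> \<gamma>' x = \<gamma> x"
  have "F \<gamma>' = F \<gamma>" using Sel_cong assms eq by blast
  then show "tick_sel r F \<gamma>' = tick_sel r F \<gamma>" by (simp add: tick_sel_def)
qed (simp add: tick_sel_def case_prod_unfold snd_Sel[OF assms])

lemma bind_list_Sel:
  assumes "list_all2 (\<lambda>F X. F \<in> Sel X) Fs Xs"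
    and "\<And>xs. list_all2 (\<in>) xs Xs \<Longrightarrow> k xs \<in> Sel Y"
  shows "bind_list Fs k \<in> Sel Y"
  using assms
proof (induction Fs Xs arbitrary: k rule: list_all2_induct)
  case (Cons F Fs X Xs)
  then show ?case by (auto intro!: kleisli_Sel)
qed simp

section \<open>Denotations of well-typed terms\<close>

text \<open>In an application this puts the type of the operator into \<open>T\<close>, where the
  coding is faithful.\<close>

lemma typing_imp_mem: "typing S T \<Gamma> M \<sigma> \<Longrightarrow> \<sigma> \<in> T"
  by (induction rule: typing.induct) auto

text \<open>Every free index of a well-typed term is below the length of its context, so it never
  reaches the trailing entries. Abstractions obtained by substituting closed values thereby get a
  denotation independent of the environment.\<close>

lemma sem_append:
  assumes "typing S T \<Gamma> M \<sigma>" "length \<rho> = length \<Gamma>"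
  shows "sem I K M (\<rho> @ \<rho>') = sem I K M \<rho>"
  using assms
proof (induction arbitrary: \<rho> rule: typing.induct)
  case (typing_Fn \<Gamma> Ms f b)
  have "map (\<lambda>M. sem I K M (\<rho> @ \<rho>')) Ms = map (\<lambda>M. sem I K M \<rho>) Ms"
    using typing_Fn(1,4) by (auto simp: list_all2_conv_all_nth in_set_conv_nth)
  then show ?case by (simp only: sem.simps)
next
  case (typing_Lam \<sigma> \<Gamma> M \<tau>)
  then have "sem I K M (a # \<rho> @ \<rho>') = sem I K M (a # \<rho>)" for a
    using typing_Lam.IH[of "a # \<rho>"] by simp
  then show ?case by simp
qed (simp_all add: nth_append cong: if_cong)

lemma app_sval_Sel:
  assumes "wf_coding I K T" "Arrow \<sigma> \<tau> \<in> T" "g \<in> Sty I K (Arrow \<sigma> \<tau>)" "a \<in> Sty I K \<sigma>"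
  shows "app_sval K g a \<in> Sel (Sty I K \<tau>)"
proof -
  from assms(3) obtain F where F: "F \<in> Sty I K \<sigma> \<rightarrow>\<^sub>E Sel (Sty I K \<tau>)" "g = FunV (enc K F)"
    by auto
  with assms(1,2) have "dec K (enc K F) = F" unfolding wf_coding_def by blast
  with F assms(4) show ?thesis by auto
qed

text \<open>What matters is the body of an abstraction: its denotation must lie in the full function
  space, because only there is decoding known to undo encoding.\<close>

lemma sem_Sel:
  assumes "wf_interp S I" "wf_coding I K T"
    and "typing S T \<Gamma> M \<sigma>" "list_all2 (\<lambda>a \<sigma>. a \<in> Sty I K \<sigma>) \<rho> \<Gamma>"
  shows "sem I K M \<rho> \<in> Sel (Sty I K \<sigma>)"
  using assms(3,4)
proof (induction arbitrary: \<rho> rule: typing.induct)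
  case (typing_Var i \<Gamma> \<sigma>)
  then show ?case by (auto intro: eta_Sel simp: list_all2_conv_all_nth)
next
  case (typing_Con c b \<Gamma>)
  then show ?case using assms(1) by (auto intro!: eta_Sel simp: wf_interp_def)
next
  case (typing_Fn \<Gamma> Ms f b)
  have "list_all2 (\<lambda>F X. F \<in> Sel X) (map (\<lambda>M. sem I K M \<rho>) Ms)
      (map (\<lambda>b. Sty I K (Base b)) (fargs S f))"
    using typing_Fn(1,4) by (auto simp: list_all2_conv_all_nth)
  moreover have "eta (BaseV (fden I f (map the_base xs))) \<in> Sel (Sty I K (Base b))"
    if "list_all2 (\<in>) xs (map (\<lambda>b. Sty I K (Base b)) (fargs S f))" for xs
  proof -
    have "list_all2 (\<lambda>x b. x \<in> bden I b) (map the_base xs) (fargs S f)"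
      using that by (fastforce simp: list_all2_conv_all_nth)
    then have "fden I f (map the_base xs) \<in> bden I b"
      using assms(1) typing_Fn(2) unfolding wf_interp_def by blast
    then show ?thesis by (auto intro: eta_Sel)
  qed
  ultimately show ?case unfolding sem.simps by (rule bind_list_Sel)
next
  case (typing_Cond \<Gamma> L M \<sigma> N)
  then show ?case unfolding sem.simps by (intro kleisli_Sel) (auto split: if_split)
next
  case (typing_Or \<Gamma> M \<sigma> N)
  then show ?case by (auto intro: or_Sel)
next
  case (typing_Tick \<Gamma> N M \<sigma>)
  then show ?case unfolding sem.simps by (intro kleisli_Sel tick_Sel) auto
next
  case (typing_Star \<Gamma>)
  show ?case by (auto intro: eta_Sel)
next
  case (typing_Pair \<Gamma> M \<sigma> N \<tau>)
  show ?case unfolding sem.simps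
    by (rule kleisli_Sel[OF typing_Pair.IH(1)[OF typing_Pair.prems]],
        rule kleisli_Sel[OF typing_Pair.IH(2)[OF typing_Pair.prems]]) (auto intro: eta_Sel)
next
  case (typing_Fst \<Gamma> M \<sigma> \<tau>)
  show ?case unfolding sem.simps
    by (rule kleisli_Sel[OF typing_Fst.IH[OF typing_Fst.prems]]) (auto intro: eta_Sel)
next
  case (typing_Snd \<Gamma> M \<sigma> \<tau>)
  show ?case unfolding sem.simps
    by (rule kleisli_Sel[OF typing_Snd.IH[OF typing_Snd.prems]]) (auto intro: eta_Sel)
next
  case (typing_Lam \<sigma> \<Gamma> M \<tau>)
  have "(\<lambda>a\<in>Sty I K \<sigma>. sem I K M (a # \<rho>)) \<in> Sty I K \<sigma> \<rightarrow>\<^sub>E Sel (Sty I K \<tau>)"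
    using typing_Lam.IH typing_Lam.prems by auto
  then show ?case unfolding sem.simps Sty.simps by (intro eta_Sel imageI)
next
  case (typing_App \<Gamma> M \<sigma> \<tau> N)
  have "Arrow \<sigma> \<tau> \<in> T" using typing_App.hyps(1) by (rule typing_imp_mem)
  note app = app_sval_Sel[OF assms(2) this]
  show ?case unfolding sem.simps
    by (rule kleisli_Sel[OF typing_App.IH(1)[OF typing_App.prems]],
        rule kleisli_Sel[OF typing_App.IH(2)[OF typing_App.prems]]) (rule app)
qed

section \<open>Simultaneous substitution of closed values\<close>

text \<open>The parameter \<open>k\<close> counts the binders passed; the \<open>length Vs\<close>
  indices from \<open>k\<close> on are replaced and larger ones lowered. As with
  \<open>subst\<close>, nothing is shifted because the substituted values are closed.\<close>

fun psubst :: "nat \<Rightarrow> ('b, 'c, 'f) tm list \<Rightarrow> ('b, 'c, 'f) tm \<Rightarrow> ('b, 'c, 'f) tm" where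
  "psubst k Vs (Var i) =
     (if i < k then Var i else if i < k + length Vs then Vs ! (i - k) else Var (i - length Vs))"
| "psubst k Vs (Con c) = Con c"
| "psubst k Vs (Fn f Ms) = Fn f (map (psubst k Vs) Ms)"
| "psubst k Vs (Cond L M N) = Cond (psubst k Vs L) (psubst k Vs M) (psubst k Vs N)"
| "psubst k Vs (Or M N) = Or (psubst k Vs M) (psubst k Vs N)"
| "psubst k Vs (Tick N M) = Tick (psubst k Vs N) (psubst k Vs M)"
| "psubst k Vs Star = Star"
| "psubst k Vs (Pair M N) = Pair (psubst k Vs M) (psubst k Vs N)"
| "psubst k Vs (Fst M) = Fst (psubst k Vs M)"
| "psubst k Vs (Snd M) = Snd (psubst k Vs M)"
| "psubst k Vs (Lam \<sigma> M) = Lam \<sigma> (psubst (Suc k) Vs M)"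
| "psubst k Vs (App M N) = App (psubst k Vs M) (psubst k Vs N)"

text \<open>Closedness is expressed by the two consequences used below: invariance under
  substitution, and a denotation that ignores the environment.\<close>

definition closed_value :: "('b, 'c, 'f, 'r :: {comm_monoid_add, linorder}, 'd) interp \<Rightarrow>
    ('r, 'd, 'u) coding \<Rightarrow> ('b, 'c, 'f) tm \<Rightarrow> bool" where
  "closed_value I K V \<longleftrightarrow> is_val V \<and> (\<forall>k W. subst k W V = V) \<and>
     (\<forall>\<rho>. sem I K V \<rho> = eta (pure_sem I K V))"

lemma psubst_Nil: "psubst k [] M = M"
  by (induction M arbitrary: k) (auto intro: map_idI)

lemma psubst_single: "psubst k [V] M = subst k V M"
  by (induction k V M rule: subst.induct) auto

text \<open>The values inserted first are unaffected by inserting \<open>W\<close>. A beta reduct of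
  a substituted abstraction is therefore an instance of its body under a longer list of values, as
  the induction hypothesis requires.\<close>

lemma subst_psubst:
  assumes "\<And>V k W. V \<in> set Vs \<Longrightarrow> subst k W V = V"
  shows "subst k W (psubst (Suc k) Vs M) = psubst k (W # Vs) M"
proof (induction M arbitrary: k)
  case (Var i)
  have "Vs ! (i - Suc k) \<in> set Vs" if "\<not> i < Suc k" "i < Suc k + length Vs"
    using that by auto
  then show ?case using assms by (auto simp: nth_Cons' Suc_diff_Suc)
qed simp_all

text \<open>The context has at most \<open>k + length Vs\<close> entries, so after substitution only
  indices below \<open>k\<close> remain free.\<close>

lemma subst_psubst_closed:
  assumes "\<And>V k W. V \<in> set Vs \<Longrightarrow> subst k W V = V"
    and "typing S T \<Gamma> M \<sigma>" "length \<Gamma> \<le> k + length Vs" "k \<le> j"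
  shows "subst j W (psubst k Vs M) = psubst k Vs M"
  using assms(2-)
proof (induction arbitrary: k j rule: typing.induct)
  case (typing_Fn \<Gamma> Ms f b)
  then show ?case by (auto simp: list_all2_conv_all_nth in_set_conv_nth)
qed (use assms(1) in \<open>auto simp: less_diff_conv2\<close>)

text \<open>The substitution lemma: substituting values amounts to inserting their denotations into
  the environment. The prefix \<open>\<rho>\<close> serves the binders passed; the suffix
  \<open>\<rho>'\<close> serves the lowered indices.\<close>

lemma sem_psubst:
  assumes "\<And>V \<rho>. V \<in> set Vs \<Longrightarrow> sem I K V \<rho> = eta (pure_sem I K V)" "length \<rho> = k"
  shows "sem I K (psubst k Vs M) (\<rho> @ \<rho>') = sem I K M (\<rho> @ map (pure_sem I K) Vs @ \<rho>')"
  using assms(2)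
proof (induction M arbitrary: k \<rho>)
  case (Var i)
  have "Vs ! (i - k) \<in> set Vs" if "\<not> i < k" "i < k + length Vs"
    using that by auto
  with Var show ?case using assms(1) by (auto simp: nth_append add.commute)
next
  case (Fn f Ms)
  then have "map (\<lambda>M. sem I K (psubst k Vs M) (\<rho> @ \<rho>')) Ms =
      map (\<lambda>M. sem I K M (\<rho> @ map (pure_sem I K) Vs @ \<rho>')) Ms"
    by auto
  then show ?case by (simp only: psubst.simps sem.simps map_map o_def)
next
  case (Lam \<sigma> M)
  have "sem I K (psubst (Suc k) Vs M) (a # \<rho> @ \<rho>') = sem I K M (a # \<rho> @ map (pure_sem I K) Vs @ \<rho>')"
    for a using Lam(1)[of "a # \<rho>"] Lam(2) by simp
  then show ?case by simp
qed (simp_all cong: if_cong)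

section \<open>Effect values\<close>

primrec leaves :: "('b, 'c, 'f) effval \<Rightarrow> ('b, 'c, 'f) tm set" where
  "leaves (EVal V) = {V}"
| "leaves (EOr X1 X2) = leaves X1 \<union> leaves X2"
| "leaves (ETick c X) = leaves X"

text \<open>Effect values are trees over the two operations; this is the bind of the tree
  monad.\<close>

primrec graft :: "('b, 'c, 'f) effval \<Rightarrow> (('b, 'c, 'f) tm \<Rightarrow> ('b, 'c, 'f) effval) \<Rightarrow>
    ('b, 'c, 'f) effval" where
  "graft (EVal V) f = f V"
| "graft (EOr X1 X2) f = EOr (graft X1 f) (graft X2 f)"
| "graft (ETick c X) f = ETick c (graft X f)"

primrec esem :: "('b, 'c, 'f, 'r :: {comm_monoid_add, linorder}, 'd) interp \<Rightarrow>
    ('r, 'd, 'u) coding \<Rightarrow> ('b, 'c, 'f) effval \<Rightarrow> ('r, ('r, 'd, 'u) sval) sel" where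
  "esem I K (EVal V) = eta (pure_sem I K V)"
| "esem I K (EOr X1 X2) = or_sel (esem I K X1) (esem I K X2)"
| "esem I K (ETick c X) = tick_sel (the_rew (cden I c)) (esem I K X)"

lemma leaves_graft: "leaves (graft X f) = (\<Union>V\<in>leaves X. leaves (f V))"
  by (induction X) auto

text \<open>Kleisli extension preserves both operations, so it passes down the tree; at a leaf it is
  the unit law.\<close>

lemma esem_graft:
  assumes "\<And>V. V \<in> leaves X \<Longrightarrow> esem I K (f V) = k (pure_sem I K V)"
  shows "esem I K (graft X f) = kleisli k (esem I K X)"
  using assms by (induction X) (simp_all add: kleisli_or kleisli_tick)

section \<open>Evaluation inside a context\<close>

primrec ectx_comp :: "('b, 'c, 'f) ectx \<Rightarrow> ('b, 'c, 'f) ectx \<Rightarrow> ('b, 'c, 'f) ectx" where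
  "ectx_comp Hole D = D"
| "ectx_comp (CFn f cs E Ms) D = CFn f cs (ectx_comp E D) Ms"
| "ectx_comp (CCond E M N) D = CCond (ectx_comp E D) M N"
| "ectx_comp (CTick E M) D = CTick (ectx_comp E D) M"
| "ectx_comp (CPairL E N) D = CPairL (ectx_comp E D) N"
| "ectx_comp (CPairR V E) D = CPairR V (ectx_comp E D)"
| "ectx_comp (CFst E) D = CFst (ectx_comp E D)"
| "ectx_comp (CSnd E) D = CSnd (ectx_comp E D)"
| "ectx_comp (CAppL E N) D = CAppL (ectx_comp E D) N"
| "ectx_comp (CAppR \<sigma> M E) D = CAppR \<sigma> M (ectx_comp E D)"

lemma plug_ectx_comp: "plug (ectx_comp E D) Q = plug E (plug D Q)"
  by (induction E) simp_all

lemma is_ectx_comp: "is_ectx (ectx_comp E D) \<longleftrightarrow> is_ectx E \<and> is_ectx D"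
  by (induction E) auto

lemma step_plug: "step S M M' \<Longrightarrow> is_ectx E \<Longrightarrow> step S (plug E M) (plug E M')"
  by (erule step.cases) (metis is_ectx_comp plug_ectx_comp step.intros)

lemma redex_imp_step: "redex S Q Q' \<Longrightarrow> step S Q Q'"
  using step.intros[of Hole] by simp

text \<open>Evaluating \<open>M\<close> inside \<open>E\<close> first unfolds the tree of
  \<open>M\<close>, each rule being reused in the composite of \<open>E\<close> with its own
  context, and then continues from every leaf.\<close>

lemma evaluates_plug:
  assumes "evaluates S M X" "is_ectx E"
    and "\<And>V. V \<in> leaves X \<Longrightarrow> evaluates S (plug E V) (f V)"
  shows "evaluates S (plug E M) (graft X f)"
  using assms
proof (induction rule: evaluates.induct)
  case (2 M M' X)
  then show ?case by (auto intro: evaluates.intros(2) step_plug)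
next
  case (3 D M1 X1 M2 X2)
  then show ?case using evaluates.intros(3)[of "ectx_comp E D"]
    by (simp add: plug_ectx_comp is_ectx_comp)
next
  case (4 D M1 X c)
  then show ?case using evaluates.intros(4)[of "ectx_comp E D"]
    by (simp add: plug_ectx_comp is_ectx_comp)
qed simp

section \<open>Adequate terms and the logical relation\<close>

text \<open>The set \<open>P\<close> is a parameter so that \<open>red\<close> can be defined by
  recursion on types, using adequacy at the smaller result type.\<close>

definition adequate :: "('b, 'c, 'f) signature \<Rightarrow>
    ('b, 'c, 'f, 'r :: {comm_monoid_add, linorder}, 'd) interp \<Rightarrow> ('r, 'd, 'u) coding \<Rightarrow>
    ('b, 'c, 'f) tm set \<Rightarrow> ('b, 'c, 'f) tm \<Rightarrow> bool" where
  "adequate S I K P M \<longleftrightarrow>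
     (\<exists>X. evaluates S M X \<and> leaves X \<subseteq> P \<and> sem I K M [] = esem I K X)"

text \<open>At function types the usual reducibility condition is joined by semantic ones: the
  denotation lies in the function space, and its code decodes to the denotation of the body. These
  justify beta reduction denotationally.\<close>

primrec red :: "('b, 'c, 'f) signature \<Rightarrow>
    ('b, 'c, 'f, 'r :: {comm_monoid_add, linorder}, 'd) interp \<Rightarrow> ('r, 'd, 'u) coding \<Rightarrow>
    'b ty \<Rightarrow> ('b, 'c, 'f) tm set" where
  "red S I K (Base b) = {Con c | c. cty S c = b}"
| "red S I K UnitT = {Star}"
| "red S I K (Prod \<sigma> \<tau>) = {Pair V W | V W. V \<in> red S I K \<sigma> \<and> W \<in> red S I K \<tau>}"
| "red S I K (Arrow \<sigma> \<tau>) = {Lam \<sigma> N | N. closed_value I K (Lam \<sigma> N) \<and>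
     pure_sem I K (Lam \<sigma> N) \<in> Sty I K (Arrow \<sigma> \<tau>) \<and>
     (\<forall>a \<in> Sty I K \<sigma>. app_sval K (pure_sem I K (Lam \<sigma> N)) a = sem I K N [a]) \<and>
     (\<forall>W \<in> red S I K \<sigma>. adequate S I K (red S I K \<tau>) (subst 0 W N))}"

lemma red_closed_value: "V \<in> red S I K \<sigma> \<Longrightarrow> closed_value I K V"
  by (induction \<sigma> arbitrary: V) (auto simp: closed_value_def intro: is_val.intros)

lemma red_pure_sem: "wf_interp S I \<Longrightarrow> V \<in> red S I K \<sigma> \<Longrightarrow> pure_sem I K V \<in> Sty I K \<sigma>"
proof (induction \<sigma> arbitrary: V)
  case (Arrow \<sigma> \<tau>)
  then show ?case by (auto simp del: Sty.simps pure_sem.simps)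
qed (auto simp: wf_interp_def)

lemma red_sem: "V \<in> red S I K \<sigma> \<Longrightarrow> sem I K V \<rho> = eta (pure_sem I K V)"
  using red_closed_value unfolding closed_value_def by blast

lemma red_is_val: "V \<in> red S I K \<sigma> \<Longrightarrow> is_val V"
  using red_closed_value unfolding closed_value_def by blast

lemma adequate_red: "V \<in> red S I K \<sigma> \<Longrightarrow> adequate S I K (red S I K \<sigma>) V"
  unfolding adequate_def
  by (rule exI[of _ "EVal V"]) (simp add: red_sem red_is_val evaluates.intros(1))

text \<open>Closure under head expansion, given that the reduction preserves the denotation.\<close>

lemma adequate_redex:
  assumes "redex S M M'" "sem I K M [] = sem I K M' []" "adequate S I K P M'"
  shows "adequate S I K P M"
  using assms evaluates.intros(2)[OF redex_imp_step[OF assms(1)]]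
  unfolding adequate_def by metis

text \<open>Here \<open>k\<close> is the denotation of the context as a continuation. Operationally
  the trees for the plugged leaves are grafted onto the tree of \<open>M\<close>; denotationally
  this is Kleisli extension by \<open>k\<close>.\<close>

lemma adequate_plug:
  assumes M: "adequate S I K P M" and E: "is_ectx E"
    and V: "\<And>V. V \<in> P \<Longrightarrow> adequate S I K Q (plug E V)"
    and k: "\<And>V. V \<in> P \<Longrightarrow> sem I K (plug E V) [] = k (pure_sem I K V)"
      "sem I K (plug E M) [] = kleisli k (sem I K M [])"
  shows "adequate S I K Q (plug E M)"
proof -
  from M obtain X where X: "evaluates S M X" "leaves X \<subseteq> P" "sem I K M [] = esem I K X"
    unfolding adequate_def by blast
  \<comment> \<open>The function \<open>f\<close> chooses an effect value for each possible
    leaf.\<close>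
  from V obtain f where f: "\<And>V. V \<in> P \<Longrightarrow> evaluates S (plug E V) (f V) \<and> leaves (f V) \<subseteq> Q \<and>
      sem I K (plug E V) [] = esem I K (f V)"
    unfolding adequate_def by metis
  have "evaluates S (plug E M) (graft X f)"
    using X(2) f by (intro evaluates_plug[OF X(1) E]) blast
  moreover have "leaves (graft X f) \<subseteq> Q" using X(2) f by (auto simp: leaves_graft)
  moreover have "esem I K (graft X f) = kleisli k (esem I K X)"
    using X(2) f k(1) by (intro esem_graft) (metis subsetD)
  ultimately show ?thesis using k(2) X(3) unfolding adequate_def by auto
qed

text \<open>The induction is on the arguments still to be evaluated, for an arbitrary prefix
  \<open>cs\<close> of constants already reached.\<close>

lemma adequate_Fn:
  fixes I :: "('b, 'c, 'f, 'r :: {comm_monoid_add, linorder}, 'd) interp"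
    and K :: "('r, 'd, 'u) coding"
  assumes wf: "wf_signature S" "wf_interp S I"
    and "list_all2 (\<lambda>M b. adequate S I K (red S I K (Base b)) M) Ms bs"
    and "map (cty S) cs @ bs = fargs S f"
  shows "adequate S I K (red S I K (Base (fres S f))) (Fn f (map Con cs @ Ms))"
  using assms(3,4)
proof (induction Ms bs arbitrary: cs rule: list_all2_induct)
  case Nil
  have 1: "map (\<lambda>M. sem I K M []) (map Con cs) = map eta (map (\<lambda>c. BaseV (cden I c)) cs)"
    by simp
  have "sem I K (Fn f (map Con cs)) [] = eta (BaseV (fden I f (map (cden I) cs)))"
    unfolding sem.simps 1 bind_list_eta_append[where Fs = "[]", simplified] by (simp add: o_def)
  also have "fden I f (map (cden I) cs) = cden I (valf S f cs)"
    using wf(2) Nil unfolding wf_interp_def by auto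
  finally have sem: "sem I K (Fn f (map Con cs)) [] = sem I K (Con (valf S f cs)) []" by simp
  have red: "Con (valf S f cs) \<in> red S I K (Base (fres S f))"
    using wf(1) Nil unfolding wf_signature_def by auto
  have "redex S (Fn f (map Con cs)) (Con (valf S f cs))"
    using Nil by (auto intro: redex.intros)
  from adequate_redex[OF this sem adequate_red[OF red]] show ?case by simp
next
  case (Cons M Ms b bs)
  have 1: "map (\<lambda>M. sem I K M []) (map Con cs) = map eta (map (\<lambda>c. BaseV (cden I c)) cs)"
    by simp
  \<comment> \<open>The continuation evaluates the remaining arguments and then applies the
    interpreted symbol.\<close>
  define k :: "('r, 'd, 'u) sfun" where "k x = bind_list (map (\<lambda>M. sem I K M []) Ms)
      (\<lambda>xs. eta (BaseV (fden I f (map the_base (map (\<lambda>c. BaseV (cden I c)) cs @ x # xs)))))" for x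
  have sem: "sem I K (Fn f (map Con cs @ N # Ms)) [] = kleisli k (sem I K N [])" for N
    unfolding sem.simps map_append 1 bind_list_eta_append k_def by simp
  have "adequate S I K (red S I K (Base (fres S f))) (plug (CFn f cs Hole Ms) M)"
  proof (rule adequate_plug[where P = "red S I K (Base b)" and k = k])
    fix V assume V: "V \<in> red S I K (Base b)"
    then show "sem I K (plug (CFn f cs Hole Ms) V) [] = k (pure_sem I K V)"
      unfolding plug.simps sem by (simp only: red_sem kleisli_eta)
    \<comment> \<open>A leaf of base type is a constant, which joins the evaluated prefix for the
      induction hypothesis.\<close>
    from V obtain c where "V = Con c" "cty S c = b" by auto
    then show "adequate S I K (red S I K (Base (fres S f))) (plug (CFn f cs Hole Ms) V)"
      using Cons.IH[of "cs @ [c]"] Cons.prems by simp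
  qed (use Cons.hyps sem in simp_all)
  then show ?case by simp
qed

text \<open>The fundamental lemma of the logical relation. Each elimination form or strict construct
  is handled by \<open>adequate_plug\<close>, one evaluation position at a time from left to
  right.\<close>

lemma adequate_psubst:
  assumes wf: "wf_signature S" "wf_interp S I" "wf_coding I K T"
    and "typing S T \<Gamma> M \<sigma>" "list_all2 (\<lambda>V \<sigma>. V \<in> red S I K \<sigma>) Vs \<Gamma>"
  shows "adequate S I K (red S I K \<sigma>) (psubst 0 Vs M)"
  using assms(4,5)
proof (induction arbitrary: Vs rule: typing.induct)
  case (typing_Var i \<Gamma> \<sigma>)
  then show ?case by (auto intro!: adequate_red simp: list_all2_conv_all_nth)
next
  case (typing_Con c b \<Gamma>)
  then show ?case using adequate_red[of "Con c" S I K "Base b"] by simp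
next
  case (typing_Fn \<Gamma> Ms f b)
  have "list_all2 (\<lambda>M b. adequate S I K (red S I K (Base b)) M) (map (psubst 0 Vs) Ms) (fargs S f)"
    unfolding list_all2_map1 using typing_Fn(1) by (rule list_all2_mono) (use typing_Fn.prems in blast)
  from adequate_Fn[OF wf(1,2) this, where f = f and cs = "[]"] typing_Fn.hyps
  show ?case by (simp del: red.simps)
next
  case (typing_Cond \<Gamma> L M \<sigma> N)
  let ?M = "psubst 0 Vs M" and ?N = "psubst 0 Vs N"
  have "adequate S I K (red S I K \<sigma>) (plug (CCond Hole ?M ?N) (psubst 0 Vs L))"
  proof (rule adequate_plug[OF typing_Cond.IH(1)[OF typing_Cond.prems], where
        k = "\<lambda>x. if x = BaseV (BoolV True) then sem I K ?M [] else sem I K ?N []"])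
    fix V assume V: "V \<in> red S I K (Base (BoolB S))"
    then obtain c where c: "V = Con c" "cty S c = BoolB S" by auto
    \<comment> \<open>There are only two truth values, and constants of one type with equal
      denotations are equal; hence \<open>c\<close> is one of the two Boolean constants.\<close>
    with wf(2) have "cden I c \<in> range BoolV" unfolding wf_interp_def by metis
    then consider "cden I c = BoolV True" | "cden I c = BoolV False" by (metis (full_types) rangeE)
    then consider "c = ttC S" | "c = ffC S"
      using wf(1,2) c(2) unfolding wf_interp_def wf_signature_def by metis
    then show "adequate S I K (red S I K \<sigma>) (plug (CCond Hole ?M ?N) V)"
    proof cases
      case 1
      have "sem I K (Cond (Con (ttC S)) ?M ?N) [] = sem I K ?M []"
        using wf(2) by (simp add: wf_interp_def)
      from adequate_redex[OF redex.intros(2) this typing_Cond.IH(2)[OF typing_Cond.prems]]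
      show ?thesis using c 1 by simp
    next
      case 2
      have "sem I K (Cond (Con (ffC S)) ?M ?N) [] = sem I K ?N []"
        using wf(2) by (simp add: wf_interp_def)
      from adequate_redex[OF redex.intros(3) this typing_Cond.IH(3)[OF typing_Cond.prems]]
      show ?thesis using c 2 by simp
    qed
  qed (auto simp: red_sem)
  then show ?case by simp
next
  case (typing_Or \<Gamma> M \<sigma> N)
  from typing_Or.IH[OF typing_Or.prems] obtain X Y where
    "evaluates S (psubst 0 Vs M) X" "leaves X \<subseteq> red S I K \<sigma>"
    "sem I K (psubst 0 Vs M) [] = esem I K X"
    "evaluates S (psubst 0 Vs N) Y" "leaves Y \<subseteq> red S I K \<sigma>"
    "sem I K (psubst 0 Vs N) [] = esem I K Y"
    unfolding adequate_def by blast
  then show ?case using evaluates.intros(3)[of Hole S "psubst 0 Vs M" X "psubst 0 Vs N" Y]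
    unfolding adequate_def by (intro exI[of _ "EOr X Y"]) simp
next
  case (typing_Tick \<Gamma> N M \<sigma>)
  let ?M = "psubst 0 Vs M"
  from typing_Tick.IH(2)[OF typing_Tick.prems] obtain X where
    X: "evaluates S ?M X" "leaves X \<subseteq> red S I K \<sigma>" "sem I K ?M [] = esem I K X"
    unfolding adequate_def by blast
  have "adequate S I K (red S I K \<sigma>) (plug (CTick Hole ?M) (psubst 0 Vs N))"
  proof (rule adequate_plug[OF typing_Tick.IH(1)[OF typing_Tick.prems], where
        k = "\<lambda>x. tick_sel (the_rew (the_base x)) (sem I K ?M [])"])
    fix V assume "V \<in> red S I K (Base (RewB S))"
    then obtain c where "V = Con c" by auto
    with X show "adequate S I K (red S I K \<sigma>) (plug (CTick Hole ?M) V)"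
      using evaluates.intros(4)[of Hole S ?M X c]
      unfolding adequate_def by (intro exI[of _ "ETick c X"]) simp
  qed (auto simp: red_sem)
  then show ?case by simp
next
  case (typing_Star \<Gamma>)
  show ?case using adequate_red[of Star S I K UnitT] by simp
next
  case (typing_Pair \<Gamma> M \<sigma> N \<tau>)
  let ?N = "psubst 0 Vs N"
  have "adequate S I K (red S I K (Prod \<sigma> \<tau>)) (plug (CPairL Hole ?N) (psubst 0 Vs M))"
  proof (rule adequate_plug[OF typing_Pair.IH(1)[OF typing_Pair.prems], where
        k = "\<lambda>a. kleisli (\<lambda>b. eta (PairV a b)) (sem I K ?N [])"])
    fix V assume V: "V \<in> red S I K \<sigma>"
    \<comment> \<open>Once the first component is the value \<open>V\<close>, evaluation moves to
      the second.\<close>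
    have "adequate S I K (red S I K (Prod \<sigma> \<tau>)) (plug (CPairR V Hole) ?N)"
    proof (rule adequate_plug[OF typing_Pair.IH(2)[OF typing_Pair.prems], where
          k = "\<lambda>b. eta (PairV (pure_sem I K V) b)"])
      fix W assume "W \<in> red S I K \<tau>"
      with V show "adequate S I K (red S I K (Prod \<sigma> \<tau>)) (plug (CPairR V Hole) W)"
        using adequate_red[of "Pair V W" S I K "Prod \<sigma> \<tau>"] by simp
    qed (use V in \<open>auto simp: red_sem red_is_val\<close>)
    then show "adequate S I K (red S I K (Prod \<sigma> \<tau>)) (plug (CPairL Hole ?N) V)" by simp
  qed (auto simp: red_sem)
  then show ?case by simp
next
  case (typing_Fst \<Gamma> M \<sigma> \<tau>)
  have "adequate S I K (red S I K \<sigma>) (plug (CFst Hole) (psubst 0 Vs M))"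
  proof (rule adequate_plug[OF typing_Fst.IH[OF typing_Fst.prems], where
        k = "\<lambda>p. eta (fst_sval p)"])
    fix V assume "V \<in> red S I K (Prod \<sigma> \<tau>)"
    then obtain A B where V: "V = Pair A B" "A \<in> red S I K \<sigma>" "B \<in> red S I K \<tau>" by auto
    then have "redex S (Fst V) A" by (simp add: redex.intros red_is_val)
    moreover have "sem I K (Fst V) [] = sem I K A []" using V by (simp add: red_sem)
    ultimately have "adequate S I K (red S I K \<sigma>) (Fst V)"
      by (rule adequate_redex) (rule adequate_red, fact)
    then show "adequate S I K (red S I K \<sigma>) (plug (CFst Hole) V)" by simp
  next
    fix V assume "V \<in> red S I K (Prod \<sigma> \<tau>)"
    then show "sem I K (plug (CFst Hole) V) [] = eta (fst_sval (pure_sem I K V))"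
      by (simp add: red_sem del: red.simps)
  qed auto
  then show ?case by simp
next
  case (typing_Snd \<Gamma> M \<sigma> \<tau>)
  have "adequate S I K (red S I K \<tau>) (plug (CSnd Hole) (psubst 0 Vs M))"
  proof (rule adequate_plug[OF typing_Snd.IH[OF typing_Snd.prems], where
        k = "\<lambda>p. eta (snd_sval p)"])
    fix V assume "V \<in> red S I K (Prod \<sigma> \<tau>)"
    then obtain A B where V: "V = Pair A B" "A \<in> red S I K \<sigma>" "B \<in> red S I K \<tau>" by auto
    then have "redex S (Snd V) B" by (simp add: redex.intros red_is_val)
    moreover have "sem I K (Snd V) [] = sem I K B []" using V by (simp add: red_sem)
    ultimately have "adequate S I K (red S I K \<tau>) (Snd V)"
      by (rule adequate_redex) (rule adequate_red, fact)
    then show "adequate S I K (red S I K \<tau>) (plug (CSnd Hole) V)" by simp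
  next
    fix V assume "V \<in> red S I K (Prod \<sigma> \<tau>)"
    then show "sem I K (plug (CSnd Hole) V) [] = eta (snd_sval (pure_sem I K V))"
      by (simp add: red_sem del: red.simps)
  qed auto
  then show ?case by simp
next
  case (typing_Lam \<sigma> \<Gamma> M \<tau>)
  let ?N = "psubst (Suc 0) Vs M" and ?\<rho> = "map (pure_sem I K) Vs"
  have Vs: "closed_value I K V" if "V \<in> set Vs" for V
    using that typing_Lam.prems red_closed_value
    by (fastforce simp: list_all2_conv_all_nth in_set_conv_nth)
  then have sub: "subst k W V = V" and sem: "sem I K V \<rho> = eta (pure_sem I K V)"
    if "V \<in> set Vs" for V k W \<rho>
    using that unfolding closed_value_def by blast+
  have len: "length Vs = length \<Gamma>" using typing_Lam.prems by (rule list_all2_lengthD)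
  have \<rho>: "list_all2 (\<lambda>a \<sigma>. a \<in> Sty I K \<sigma>) ?\<rho> \<Gamma>"
    unfolding list_all2_map1 using typing_Lam.prems
    by (rule list_all2_mono) (rule red_pure_sem[OF wf(2)])
  \<comment> \<open>The substitution lemma under one binder inserts the denotations of
    \<open>Vs\<close>; the trailing \<open>\<rho>'\<close> is then out of reach of
    \<open>M\<close>.\<close>
  have N: "sem I K ?N (a # \<rho>') = sem I K M (a # ?\<rho>)" for a \<rho>'
    using sem_psubst[of Vs I K "[a]" "Suc 0" M \<rho>', OF sem]
      sem_append[OF typing_Lam.hyps(1), of "a # ?\<rho>"] len by simp
  let ?F = "\<lambda>a\<in>Sty I K \<sigma>. sem I K ?N [a]"
  have F: "?F \<in> Sty I K \<sigma> \<rightarrow>\<^sub>E Sel (Sty I K \<tau>)"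
    using sem_Sel[OF wf(2,3) typing_Lam.hyps(1)] \<rho> by (auto simp: N)
  have dec: "dec K (enc K ?F) = ?F"
    using wf(3) typing_Lam.hyps(2) F unfolding wf_coding_def by blast
  have "subst k W (Lam \<sigma> ?N) = Lam \<sigma> ?N" for k W
    using subst_psubst_closed[OF sub typing_Lam.hyps(1)] len by simp
  moreover have "sem I K (Lam \<sigma> ?N) \<rho>' = eta (pure_sem I K (Lam \<sigma> ?N))" for \<rho>'
    by (simp add: N)
  ultimately have "closed_value I K (Lam \<sigma> ?N)"
    by (auto simp: closed_value_def intro: is_val.intros)
  moreover have "pure_sem I K (Lam \<sigma> ?N) \<in> Sty I K (Arrow \<sigma> \<tau>)"
    using F unfolding pure_sem.simps Sty.simps by (rule imageI)
  moreover have "app_sval K (pure_sem I K (Lam \<sigma> ?N)) a = sem I K ?N [a]" if "a \<in> Sty I K \<sigma>" for a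
    using that by (simp add: dec)
  \<comment> \<open>By \<open>subst_psubst\<close> the reduct is the body instantiated with
    \<open>W # Vs\<close>.\<close>
  moreover have "adequate S I K (red S I K \<tau>) (subst 0 W ?N)" if "W \<in> red S I K \<sigma>" for W
    using typing_Lam.IH[of "W # Vs"] typing_Lam.prems that subst_psubst[OF sub] by simp
  ultimately have "Lam \<sigma> ?N \<in> red S I K (Arrow \<sigma> \<tau>)" by simp
  then show ?case unfolding psubst.simps by (rule adequate_red)
next
  case (typing_App \<Gamma> M \<sigma> \<tau> N)
  let ?N = "psubst 0 Vs N"
  have "adequate S I K (red S I K \<tau>) (plug (CAppL Hole ?N) (psubst 0 Vs M))"
  proof (rule adequate_plug[OF typing_App.IH(1)[OF typing_App.prems], where
        k = "\<lambda>g. kleisli (\<lambda>a. app_sval K g a) (sem I K ?N [])"])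
    fix V assume V: "V \<in> red S I K (Arrow \<sigma> \<tau>)"
    then obtain L where L: "V = Lam \<sigma> L"
      "\<And>a. a \<in> Sty I K \<sigma> \<Longrightarrow> app_sval K (pure_sem I K V) a = sem I K L [a]"
      "\<And>W. W \<in> red S I K \<sigma> \<Longrightarrow> adequate S I K (red S I K \<tau>) (subst 0 W L)"
      by (auto simp del: pure_sem.simps)
    have app: "sem I K (App V W) [] = app_sval K (pure_sem I K V) (pure_sem I K W)"
      if "W \<in> red S I K \<sigma>" for W
      using red_sem[OF V] red_sem[OF that] by simp
    have "adequate S I K (red S I K \<tau>) (plug (CAppR \<sigma> L Hole) ?N)"
    proof (rule adequate_plug[OF typing_App.IH(2)[OF typing_App.prems], where
          k = "app_sval K (pure_sem I K V)"])
      fix W assume W: "W \<in> red S I K \<sigma>"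
      \<comment> \<open>With the decoding condition in \<open>red\<close>, this makes the beta step
        preserve the denotation.\<close>
      have "sem I K L [pure_sem I K W] = sem I K (subst 0 W L) []"
        using sem_psubst[of "[W]" I K "[]" 0 L "[]"] red_sem[OF W] by (simp add: psubst_single)
      with app[OF W] L(2)[OF red_pure_sem[OF wf(2) W]]
      have "sem I K (App V W) [] = sem I K (subst 0 W L) []" by (simp only:)
      moreover have "redex S (App V W) (subst 0 W L)"
        unfolding L(1) using red_is_val[OF W] by (rule redex.intros)
      ultimately have "adequate S I K (red S I K \<tau>) (App V W)"
        using L(3)[OF W] by (blast intro: adequate_redex)
      then show "adequate S I K (red S I K \<tau>) (plug (CAppR \<sigma> L Hole) W)"
        using L(1) by simp
    next
      fix W assume "W \<in> red S I K \<sigma>"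
      then show "sem I K (plug (CAppR \<sigma> L Hole) W) [] = app_sval K (pure_sem I K V) (pure_sem I K W)"
        using app L(1) by simp
    next
      show "sem I K (plug (CAppR \<sigma> L Hole) ?N) [] =
          kleisli (app_sval K (pure_sem I K V)) (sem I K ?N [])"
        using red_sem[OF V, of "[]"] L(1) by simp
    qed simp
    with L(1) show "adequate S I K (red S I K \<tau>) (plug (CAppL Hole ?N) V)" by simp
  next
    fix V assume "V \<in> red S I K (Arrow \<sigma> \<tau>)"
    then show "sem I K (plug (CAppL Hole ?N) V) [] =
        kleisli (\<lambda>a. app_sval K (pure_sem I K V) a) (sem I K ?N [])"
      by (simp add: red_sem del: red.simps)
  qed auto
  then show ?case by simp
qed

section \<open>Determinism of evaluation\<close>

text \<open>The terms on which evaluation acts directly: redexes, stated without side conditions on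
  the constants, and the two operations. One class for both lets a single unique decomposition
  result cover all evaluation rules.\<close>

inductive active :: "('b, 'c, 'f) tm \<Rightarrow> bool" where
    "active (Fn f (map Con cs))"
  | "active (Cond (Con c) M N)"
  | "is_val V \<Longrightarrow> is_val W \<Longrightarrow> active (Fst (Pair V W))"
  | "is_val V \<Longrightarrow> is_val W \<Longrightarrow> active (Snd (Pair V W))"
  | "is_val V \<Longrightarrow> active (App (Lam \<sigma> M) V)"
  | "active (Or M N)"
  | "active (Tick (Con c) M)"

lemma redex_active: "redex S Q Q' \<Longrightarrow> active Q"
  by (erule redex.cases) (auto intro: active.intros)

section \<open>Unique decomposition into a context and an active term\<close>

lemma plug_active_not_val: "active Q \<Longrightarrow> is_val (plug E Q) \<Longrightarrow> False"
proof (induction E)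
  case Hole
  then show ?case by (auto elim!: active.cases elim: is_val.cases)
qed (auto elim: is_val.cases)

lemma plug_active_neq:
  assumes "active Q"
  shows "\<not> is_val (plug E Q)" "plug E Q \<noteq> Con c" "Con c \<noteq> plug E Q"
    "plug E Q \<noteq> Lam \<sigma> M" "Lam \<sigma> M \<noteq> plug E Q"
    "is_val V \<Longrightarrow> is_val W \<Longrightarrow> plug E Q \<noteq> Pair V W"
    "is_val V \<Longrightarrow> is_val W \<Longrightarrow> Pair V W \<noteq> plug E Q"
  using plug_active_not_val[OF assms] by (metis is_val.intros)+

lemma map_Con_neq_append: "(\<And>c. P \<noteq> Con c) \<Longrightarrow> map Con cs \<noteq> map Con cs' @ P # Ms"
  by (metis ex_map_conv in_set_conv_decomp)

text \<open>The evaluation positions strictly inside an active term already hold values, and a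
  plugged active term is never a value.\<close>

lemma active_plug:
  assumes "active Q" "active (plug E Q)"
  shows "E = Hole"
  using assms(2)
proof cases
  case (1 f cs)
  then show ?thesis
    using map_Con_neq_append[OF plug_active_neq(2)[OF assms(1)], symmetric] by (cases E) auto
qed (cases E; auto simp: plug_active_neq[OF assms(1)])+

text \<open>The split point is the first argument that is not a constant.\<close>

lemma map_Con_append_eq:
  assumes "map Con cs @ P # Ms = map Con cs' @ P' # Ms'"
    and "\<And>c. P \<noteq> Con c" "\<And>c. P' \<noteq> Con c"
  shows "cs = cs' \<and> P = P' \<and> Ms = Ms'"
  using assms(1)
proof (induction cs arbitrary: cs')
  case Nil
  then show ?case using assms(2) by (cases cs') auto
next
  case (Cons c cs)
  then show ?case using assms(3) by (cases cs') auto
qed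

lemma plug_inject:
  assumes "active Q" "active Q'" "is_ectx E" "is_ectx E'" "plug E Q = plug E' Q'"
  shows "E = E' \<and> Q = Q'"
proof -
  \<comment> \<open>An empty \<open>E'\<close> would make \<open>plug E Q\<close> active, forcing
    \<open>E\<close> to be empty by \<open>active_plug\<close>.\<close>
  have ne: "E' \<noteq> Hole" if "plug E Q = plug E' Q'" "E \<noteq> Hole" for E E'
    using that active_plug[OF assms(1)] assms(2) by (metis plug.simps(1))
  note neq = plug_active_neq[OF assms(1)] plug_active_neq[OF assms(2)]
  from assms(3-5) show ?thesis
  proof (induction E arbitrary: E')
    case Hole
    then show ?case using active_plug[OF assms(2), of E'] assms(1) by auto
  next
    case (CFn f cs E Ms)
    then obtain cs' D Ms' where D: "E' = CFn f cs' D Ms'"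
      using ne[OF CFn.prems(3)] by (cases E') auto
    then have "map Con cs @ plug E Q # Ms = map Con cs' @ plug D Q' # Ms'"
      using CFn.prems(3) by simp
    from map_Con_append_eq[OF this plug_active_neq(2)[OF assms(1)] plug_active_neq(2)[OF assms(2)]]
      CFn.IH[of D] CFn.prems(1,2) D
    show ?case by simp
  next
    case (CCond E M N)
    then show ?case using ne[OF CCond.prems(3)] by (cases E') auto
  next
    case (CTick E M)
    then show ?case using ne[OF CTick.prems(3)] by (cases E') auto
  next
    case (CPairL E N)
    then show ?case using ne[OF CPairL.prems(3)] by (cases E') (auto simp: neq)
  next
    case (CPairR V E)
    then show ?case using ne[OF CPairR.prems(3)] by (cases E') (auto simp: neq)
  next
    case (CFst E)
    then show ?case using ne[OF CFst.prems(3)] by (cases E') auto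
  next
    case (CSnd E)
    then show ?case using ne[OF CSnd.prems(3)] by (cases E') auto
  next
    case (CAppL E N)
    then show ?case using ne[OF CAppL.prems(3)] by (cases E') (auto simp: neq)
  next
    case (CAppR \<sigma> M E)
    then show ?case using ne[OF CAppR.prems(3)] by (cases E') (auto simp: neq)
  qed
qed

section \<open>Inversion of evaluation at a decomposed program\<close>

inductive_cases redex_FnE: "redex S (Fn f Ms) Q"
inductive_cases redex_CondE: "redex S (Cond L M N) Q"
inductive_cases redex_FstE: "redex S (Fst M) Q"
inductive_cases redex_SndE: "redex S (Snd M) Q"
inductive_cases redex_AppE: "redex S (App M N) Q"
inductive_cases redex_OrE: "redex S (Or M N) Q"
inductive_cases redex_TickE: "redex S (Tick N M) Q"

lemma redex_deterministic:
  assumes "redex S Q Q1" "redex S Q Q2" "ttC S \<noteq> ffC S"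
  shows "Q1 = Q2"
  using assms(1)
proof cases
  case (1 cs f)
  with assms(2) show ?thesis by (auto elim!: redex_FnE dest: map_injective simp: inj_def)
qed (use assms(2,3) in \<open>auto elim: redex_CondE redex_FstE redex_SndE redex_AppE\<close>)

lemma evaluates_val:
  assumes "evaluates S V X" "is_val V"
  shows "X = EVal V"
  using assms(1)
proof cases
  case (2 M')
  from 2(1) show ?thesis
    using assms(2) by (auto elim!: step.cases dest: redex_active simp: plug_active_neq)
qed (use assms(2) in \<open>auto simp: plug_active_neq active.intros\<close>)

text \<open>Unique decomposition excludes the rules for values and operations, so the last rule was
  a step, contracting this same redex in this same context.\<close>

lemma evaluates_redex:
  assumes "evaluates S (plug E Q) X" "is_ectx E" "redex S Q Q'" "ttC S \<noteq> ffC S"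
  shows "evaluates S (plug E Q') X"
  using assms(1)
proof cases
  case 1
  then show ?thesis by (simp add: plug_active_neq redex_active[OF assms(3)])
next
  case (2 M')
  from 2(1) obtain D P P' where D: "plug E Q = plug D P" "M' = plug D P'" "is_ectx D" "redex S P P'"
    by (auto elim: step.cases)
  then have "E = D" "Q = P"
    using plug_inject[OF redex_active[OF assms(3)] redex_active[OF D(4)] assms(2) D(3,1)] by auto
  with D 2 redex_deterministic[OF assms(3)] assms(4) show ?thesis by blast
next
  case (3 D M1 X1 M2 X2)
  then have "Q = Or M1 M2"
    using plug_inject[OF redex_active[OF assms(3)] active.intros(6) assms(2) 3(3,1)] by blast
  with assms(3) show ?thesis by (auto elim: redex_OrE redex_TickE)
next
  case (4 D M1 Y c)
  then have "Q = Tick (Con c) M1"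
    using plug_inject[OF redex_active[OF assms(3)] active.intros(7) assms(2) 4(3,1)] by blast
  with assms(3) show ?thesis by (auto elim: redex_OrE redex_TickE)
qed

lemma evaluates_Or:
  assumes "evaluates S (plug E (Or M1 M2)) X" "is_ectx E"
  obtains X1 X2 where "X = EOr X1 X2" "evaluates S (plug E M1) X1" "evaluates S (plug E M2) X2"
  using assms(1)
proof cases
  case 1
  then show ?thesis by (simp add: plug_active_neq active.intros)
next
  case (2 M')
  from 2(1) obtain D P P' where D: "plug E (Or M1 M2) = plug D P" "is_ectx D" "redex S P P'"
    by (auto elim: step.cases)
  then have "P = Or M1 M2"
    using plug_inject[OF active.intros(6) redex_active[OF D(3)] assms(2) D(2,1)] by blast
  with D(3) show ?thesis by (auto elim: redex_OrE redex_TickE)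
next
  case (3 D N1 X1 N2 X2)
  then have "E = D" "Or M1 M2 = Or N1 N2"
    using plug_inject[OF active.intros(6) active.intros(6) assms(2) 3(3,1)] by blast+
  with 3 that show ?thesis by simp
next
  case (4 D N Y c)
  then have "Or M1 M2 = Tick (Con c) N"
    using plug_inject[OF active.intros(6) active.intros(7) assms(2) 4(3,1)] by blast
  then show ?thesis by simp
qed

lemma evaluates_Tick:
  assumes "evaluates S (plug E (Tick (Con c) M)) X" "is_ectx E"
  obtains Y where "X = ETick c Y" "evaluates S (plug E M) Y"
  using assms(1)
proof cases
  case 1
  then show ?thesis by (simp add: plug_active_neq active.intros)
next
  case (2 M')
  from 2(1) obtain D P P' where D: "plug E (Tick (Con c) M) = plug D P" "is_ectx D" "redex S P P'"
    by (auto elim: step.cases)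
  then have "P = Tick (Con c) M"
    using plug_inject[OF active.intros(7) redex_active[OF D(3)] assms(2) D(2,1)] by blast
  with D(3) show ?thesis by (auto elim: redex_OrE redex_TickE)
next
  case (3 D N1 X1 N2 X2)
  then have "Tick (Con c) M = Or N1 N2"
    using plug_inject[OF active.intros(7) active.intros(6) assms(2) 3(3,1)] by blast
  then show ?thesis by simp
next
  case (4 D N Y c')
  then have "E = D" "Tick (Con c) M = Tick (Con c') N"
    using plug_inject[OF active.intros(7) active.intros(7) assms(2) 4(3,1)] by blast+
  with 4 that show ?thesis by simp
qed

lemma evaluates_deterministic:
  assumes "ttC S \<noteq> ffC S"
  shows "evaluates S M X \<Longrightarrow> evaluates S M Y \<Longrightarrow> X = Y"
proof (induction arbitrary: Y rule: evaluates.induct)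
  case (1 V)
  then show ?case using evaluates_val by metis
next
  case (2 M M' X)
  then show ?case using evaluates_redex assms by (metis step.cases)
next
  case (3 E M1 X1 M2 X2)
  then show ?case by (metis evaluates_Or)
next
  case (4 E M1 X c)
  then show ?case by (metis evaluates_Tick)
qed

section \<open>Optimal strategies\<close>

text \<open>The description inside \<open>argmax\<close>, named so that existence can be proved
  separately.\<close>

definition optimal :: "('s \<Rightarrow> 's \<Rightarrow> bool) \<Rightarrow> 's set \<Rightarrow> ('s \<Rightarrow> 'r :: linorder) \<Rightarrow> 's \<Rightarrow> bool" where
  "optimal le A f s \<longleftrightarrow>
     s \<in> A \<and> (\<forall>s'\<in>A. f s' \<le> f s) \<and> (\<forall>s'\<in>A. (\<forall>s''\<in>A. f s'' \<le> f s') \<longrightarrow> le s s')"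

lemma strat_le_antisym:
  "strat_le X s s' \<Longrightarrow> strat_le X s' s \<Longrightarrow> s = s'"
  by (induction X s s' rule: strat_le.induct) auto

lemma argmax_eq:
  assumes "optimal (strat_le X) A f s"
  shows "argmax (strat_le X) A f = s"
  unfolding argmax_def
proof (rule the_equality)
  fix s' assume "s' \<in> A \<and> (\<forall>t\<in>A. f t \<le> f s') \<and> (\<forall>t\<in>A. (\<forall>u\<in>A. f u \<le> f t) \<longrightarrow> strat_le X s' t)"
  then show "s' = s" using assms unfolding optimal_def by (blast intro: strat_le_antisym)
qed (use assms in \<open>simp add: optimal_def\<close>)

lemma Rew_simps:
  "Rew I (One s) (EOr X1 X2) = Rew I s X1"
  "Rew I (Two s) (EOr X1 X2) = Rew I s X2"
  "Rew I s (ETick c X) = the_rew (cden I c) + Rew I s X"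
  by (simp_all add: Rew_def case_prod_unfold)

text \<open>At the zero reward function the reward of each branch is what its own optimal strategy
  accumulates, so the local comparisons made by \<open>or_sel\<close> find the global
  maximum.\<close>

lemma esem_zero:
  fixes I :: "('b, 'c, 'f, 'r :: {comm_monoid_add, linorder}, 'd) interp"
  assumes "reward_order TYPE('r)"
  shows "\<exists>s. optimal (strat_le X) (Str X) (\<lambda>s. Rew I s X) s \<and>
    esem I K X (\<lambda>_. 0) = (Rew I s X, pure_sem I K (snd (Out I s X)))"
proof (induction X)
  case (EVal V)
  show ?case by (rule exI[of _ Done]) (simp add: optimal_def eta_def Rew_def)
next
  case (EOr X1 X2)
  then obtain s1 s2 where
    s1: "optimal (strat_le X1) (Str X1) (\<lambda>s. Rew I s X1) s1"
      "esem I K X1 (\<lambda>_. 0) = (Rew I s1 X1, pure_sem I K (snd (Out I s1 X1)))" and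
    s2: "optimal (strat_le X2) (Str X2) (\<lambda>s. Rew I s X2) s2"
      "esem I K X2 (\<lambda>_. 0) = (Rew I s2 X2, pure_sem I K (snd (Out I s2 X2)))" by blast
  have rew: "rew (esem I K X1) (\<lambda>_. 0) = Rew I s1 X1" "rew (esem I K X2) (\<lambda>_. 0) = Rew I s2 X2"
    by (simp_all add: rew_def s1(2) s2(2))
  show ?case
  \<comment> \<open>This is the test made by \<open>or_sel\<close>. A tie goes to the left, just as
    \<open>One\<close> strategies precede \<open>Two\<close> strategies.\<close>
  proof (cases "Rew I s2 X2 \<le> Rew I s1 X1")
    case True
    with s1(1) s2(1)
    have "optimal (strat_le (EOr X1 X2)) (Str (EOr X1 X2)) (\<lambda>s. Rew I s (EOr X1 X2)) (One s1)"
      unfolding optimal_def by (auto simp: Rew_simps ball_Un intro: order_trans)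
    with True s1(2) show ?thesis
      by (intro exI[of _ "One s1"]) (simp add: or_sel_def rew Rew_simps)
  next
    case False
    \<comment> \<open>Strictness matters: no \<open>One\<close> strategy may be a maximizer, since
      it would precede \<open>Two s2\<close>.\<close>
    then have "Rew I s X1 < Rew I s2 X2" if "s \<in> Str X1" for s
      using s1(1) that unfolding optimal_def by (meson le_less_trans not_le)
    with False s1(1) s2(1)
    have "optimal (strat_le (EOr X1 X2)) (Str (EOr X1 X2)) (\<lambda>s. Rew I s (EOr X1 X2)) (Two s2)"
      unfolding optimal_def by (auto simp: Rew_simps ball_Un less_imp_le; meson not_le)
    with False s2(2) show ?thesis
      by (intro exI[of _ "Two s2"]) (simp add: or_sel_def rew Rew_simps)
  qed
next
  case (ETick c X)
  then obtain s where s: "optimal (strat_le X) (Str X) (\<lambda>s. Rew I s X) s"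
    "esem I K X (\<lambda>_. 0) = (Rew I s X, pure_sem I K (snd (Out I s X)))" by blast
  \<comment> \<open>Cancellation: adding the reward of \<open>c\<close> neither creates nor destroys
    maximizers.\<close>
  have le: "t + a \<le> t + b \<longleftrightarrow> a \<le> b" for t a b :: 'r
    using assms unfolding reward_order_def by (metis add.commute)
  from s(1) have "optimal (strat_le (ETick c X)) (Str (ETick c X)) (\<lambda>s. Rew I s (ETick c X)) s"
    unfolding optimal_def by (simp add: Rew_simps le)
  moreover have "esem I K (ETick c X) (\<lambda>_. 0) =
      (Rew I s (ETick c X), pure_sem I K (snd (Out I s (ETick c X))))"
    using s(2) by (simp add: tick_sel_def Rew_simps case_prod_unfold)
  ultimately show ?case by blast
qed

theorem theorem4p6:
  fixes S :: "('b, 'c, 'f) signature"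
    and I :: "('b, 'c, 'f, 'r :: {comm_monoid_add, linorder}, 'd) interp"
    and K :: "('r, 'd, 'u) coding"
    and T :: "'b ty set"
    and M V :: "('b, 'c, 'f) tm"
    and \<sigma> :: "'b ty"
    and r :: 'r
  assumes "wf_signature S"
    and "reward_order TYPE('r)"
    and "wf_interp S I"
    and "component_closed T"
    and "wf_coding I K T"
    and "typing S T [] M \<sigma>"
    and "Op_s S I M = (r, V)"
  shows "sem I K M [] (\<lambda>_. 0) = (r, pure_sem I K V)"
proof -
  \<comment> \<open>The closed program is its own instance under the empty substitution.\<close>
  have "adequate S I K (red S I K \<sigma>) M"
    using adequate_psubst[OF assms(1,3,5,6), of "[]"] by (simp add: psubst_Nil)
  then obtain X where X: "evaluates S M X" "sem I K M [] = esem I K X"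
    unfolding adequate_def by blast
  \<comment> \<open>The two constants have different denotations. Were they equal, a conditional
    could reduce to either branch.\<close>
  have "ttC S \<noteq> ffC S" using assms(3) unfolding wf_interp_def by auto
  from evaluates_deterministic[OF this _ X(1)] X(1) have "Op S M = X"
    unfolding Op_def by (rule the_equality[rotated])
  moreover obtain s where s: "optimal (strat_le X) (Str X) (\<lambda>s. Rew I s X) s"
    "esem I K X (\<lambda>_. 0) = (Rew I s X, pure_sem I K (snd (Out I s X)))"
    using esem_zero[OF assms(2)] by blast
  ultimately have "Out I s X = (r, V)"
    using assms(7) argmax_eq[OF s(1)] by (simp add: Op_s_def)
  with s(2) X(2) show ?thesis by (simp add: Rew_def)
qed

end
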